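(* Let $\Phi=(A;E_0,\ldots,E_d;A^*;E^*_0,\ldots,E^*_d)$ be a Leonard system in $\mathcal A$ with eigenvalue sequence $\theta_0,\ldots,\theta_d$, dual eigenvalue sequence $\theta^*_0,\ldots,\theta^*_d$, first split sequence $\varphi_1,\ldots,\varphi_d$ and second split sequence $\phi_1,\ldots,\phi_d$. For $g\in S_4$ let $A^g$ and $A^{*g}$ denote the matrices representing $A$ and $A^*$ with respect to the basis $\lbrack g\rbrack$ of $V$. Then the entries of $A^g$ and $A^{*g}$ are as follows, where diagonal entries $(i,i)$ are for $0\le i\le d$ and entries $(i,i-1)$, $(i-1,i)$ are for $1\le i\le d$; every entry not displayed is zero. I. For the following 16 elements $g$ we list $\bigl(A^g_{i,i-1},A^g_{ii},A^g_{i-1,i}\,;\,A^{*g}_{i,i-1},A^{*g}_{ii},A^{*g}_{i-1,i}\bigr)$: $d^*00^*d$: $(1,\theta_i,0;\ 0,\theta^*_i,\varphi_i)$ $0d^*0^*d$: $(\varphi_i,\theta_i,0;\ 0,\theta^*_i,1)$ $d^*0d0^*$: $(0,\theta_{d-i},1;\ \varphi_{d-i+1},\theta^*_{d-i},0)$ $0d^*d0^*$: $(0,\theta_{d-i},\varphi_{d-i+1};\ 1,\theta^*_{d-i},0)$ $d0^*0d^*$: $(0,\theta_i,\varphi_i;\ 1,\theta^*_i,0)$ $0^*d0d^*$: $(0,\theta_i,1;\ \varphi_i,\theta^*_i,0)$ $d0^*d^*0$: $(\varphi_{d-i+1},\theta_{d-i},0;\ 0,\theta^*_{d-i},1)$ $0^*dd^*0$: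 $(1,\theta_{d-i},0;\ 0,\theta^*_{d-i},\varphi_{d-i+1})$ $dd^*00^*$: $(0,\theta_i,\phi_{d-i+1};\ 1,\theta^*_{d-i},0)$ $d^*d00^*$: $(0,\theta_i,1;\ \phi_{d-i+1},\theta^*_{d-i},0)$ $dd^*0^*0$: $(\phi_i,\theta_{d-i},0;\ 0,\theta^*_i,1)$ $d^*d0^*0$: $(1,\theta_{d-i},0;\ 0,\theta^*_i,\phi_i)$ $00^*dd^*$: $(0,\theta_{d-i},\phi_i;\ 1,\theta^*_i,0)$ $0^*0dd^*$: $(0,\theta_{d-i},1;\ \phi_i,\theta^*_i,0)$ $00^*d^*d$: $(\phi_{d-i+1},\theta_i,0;\ 0,\theta^*_{d-i},1)$ $0^*0d^*d$: $(1,\theta_i,0;\ 0,\theta^*_{d-i},\phi_{d-i+1})$ II. For the following 4 elements $g$: $g=d^*0^*0d$: $A^g_{ii}=\theta_i$, $A^{*g}_{ii}=a^*_i$, $$A^{*g}_{i,i-1}=\phi_{d-i+1}\frac{(\theta_i-\theta_d)\cdots(\theta_i-\theta_{i+1})}{(\theta_{i-1}-\theta_d)\cdots(\theta_{i-1}-\theta_i)},\qquad A^{*g}_{i-1,i}=\varphi_i\frac{(\theta_{i-1}-\theta_0)\cdots(\theta_{i-1}-\theta_{i-2})}{(\theta_i-\theta_0)\cdots(\theta_i-\theta_{i-1})}.$$ $g=0^*d^*0d$: $A^g_{ii}=\theta_i$, $A^{*g}_{ii}=a^*_i$, $$A^{*g}_{i,i-1}=\varphi_i\frac{(\theta_i-\theta_d)\cdots(\theta_i-\theta_{i+1})}{(\theta_{i-1}-\theta_d)\cdots(\theta_{i-1}-\theta_i)},\qquad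 A^{*g}_{i-1,i}=\phi_{d-i+1}\frac{(\theta_{i-1}-\theta_0)\cdots(\theta_{i-1}-\theta_{i-2})}{(\theta_i-\theta_0)\cdots(\theta_i-\theta_{i-1})}.$$ $g=d^*0^*d0$: $A^g_{ii}=\theta_{d-i}$, $A^{*g}_{ii}=a^*_{d-i}$, $$A^{*g}_{i,i-1}=\varphi_{d-i+1}\frac{(\theta_{d-i}-\theta_0)\cdots(\theta_{d-i}-\theta_{d-i-1})}{(\theta_{d-i+1}-\theta_0)\cdots(\theta_{d-i+1}-\theta_{d-i})},\qquad A^{*g}_{i-1,i}=\phi_i\frac{(\theta_{d-i+1}-\theta_d)\cdots(\theta_{d-i+1}-\theta_{d-i+2})}{(\theta_{d-i}-\theta_d)\cdots(\theta_{d-i}-\theta_{d-i+1})}.$$ $g=0^*d^*d0$: $A^g_{ii}=\theta_{d-i}$, $A^{*g}_{ii}=a^*_{d-i}$, $$A^{*g}_{i,i-1}=\phi_i\frac{(\theta_{d-i}-\theta_0)\cdots(\theta_{d-i}-\theta_{d-i-1})}{(\theta_{d-i+1}-\theta_0)\cdots(\theta_{d-i+1}-\theta_{d-i})},\qquad A^{*g}_{i-1,i}=\varphi_{d-i+1}\frac{(\theta_{d-i+1}-\theta_d)\cdots(\theta_{d-i+1}-\theta_{d-i+2})}{(\theta_{d-i}-\theta_d)\cdots(\theta_{d-i}-\theta_{d-i+1})}.$$ III. For the following 4 elements $g$: $g=d00^*d^*$: $A^{*g}_{ii}=\theta^*_i$, $A^g_{ii}=a_i$, $$A^g_{i,i-1}=\phi_i\frac{(\theta^*_i-\theta^*_d)\cdots(\theta^*_i-\theta^*_{i+1})}{(\theta^*_{i-1}-\theta^*_d)\cdots(\theta^*_{i-1}-\theta^*_i)},\qquad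 A^g_{i-1,i}=\varphi_i\frac{(\theta^*_{i-1}-\theta^*_0)\cdots(\theta^*_{i-1}-\theta^*_{i-2})}{(\theta^*_i-\theta^*_0)\cdots(\theta^*_i-\theta^*_{i-1})}.$$ $g=0d0^*d^*$: $A^{*g}_{ii}=\theta^*_i$, $A^g_{ii}=a_i$, $$A^g_{i,i-1}=\varphi_i\frac{(\theta^*_i-\theta^*_d)\cdots(\theta^*_i-\theta^*_{i+1})}{(\theta^*_{i-1}-\theta^*_d)\cdots(\theta^*_{i-1}-\theta^*_i)},\qquad A^g_{i-1,i}=\phi_i\frac{(\theta^*_{i-1}-\theta^*_0)\cdots(\theta^*_{i-1}-\theta^*_{i-2})}{(\theta^*_i-\theta^*_0)\cdots(\theta^*_i-\theta^*_{i-1})}.$$ $g=d0d^*0^*$: $A^{*g}_{ii}=\theta^*_{d-i}$, $A^g_{ii}=a_{d-i}$, $$A^g_{i,i-1}=\varphi_{d-i+1}\frac{(\theta^*_{d-i}-\theta^*_0)\cdots(\theta^*_{d-i}-\theta^*_{d-i-1})}{(\theta^*_{d-i+1}-\theta^*_0)\cdots(\theta^*_{d-i+1}-\theta^*_{d-i})},\qquad A^g_{i-1,i}=\phi_{d-i+1}\frac{(\theta^*_{d-i+1}-\theta^*_d)\cdots(\theta^*_{d-i+1}-\theta^*_{d-i+2})}{(\theta^*_{d-i}-\theta^*_d)\cdots(\theta^*_{d-i}-\theta^*_{d-i+1})}.$$ $g=0dd^*0^*$: $A^{*g}_{ii}=\theta^*_{d-i}$, $A^g_{ii}=a_{d-i}$,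 $$A^g_{i,i-1}=\phi_{d-i+1}\frac{(\theta^*_{d-i}-\theta^*_0)\cdots(\theta^*_{d-i}-\theta^*_{d-i-1})}{(\theta^*_{d-i+1}-\theta^*_0)\cdots(\theta^*_{d-i+1}-\theta^*_{d-i})},\qquad A^g_{i-1,i}=\varphi_{d-i+1}\frac{(\theta^*_{d-i+1}-\theta^*_d)\cdots(\theta^*_{d-i+1}-\theta^*_{d-i+2})}{(\theta^*_{d-i}-\theta^*_d)\cdots(\theta^*_{d-i}-\theta^*_{d-i+1})}.$$
   Context: Let $\mathbb K$ be an arbitrary field and $d\ge 0$ an integer. $\mathrm{Mat}_{d+1}(\mathbb K)$ is the $\mathbb K$-algebra of $(d+1)\times(d+1)$ matrices over $\mathbb K$, rows and columns indexed by $0,1,\ldots,d$; $\mathcal A$ is a $\mathbb K$-algebra isomorphic to it, with identity $I$. An element of $\mathcal A$ is multiplicity-free if it has $d+1$ distinct eigenvalues (roots of its minimal polynomial), all in $\mathbb K$. If $X\in\mathcal A$ is multiplicity-free with eigenvalues $\xi_0,\ldots,\xi_d$, the primitive idempotent of $X$ associated with $\xi_i$ is $\prod_{j\ne i}(X-\xi_jI)/(\xi_i-\xi_j)$. A Leonard system in $\mathcal A$ is a sequence $\Phi=(A;E_0,\ldots,E_d;A^*;E^*_0,\ldots,E^*_d)$ such that: (i) $A,A^*\in\mathcal A$ are both multiplicity-free; (ii) $E_0,\ldots,E_d$ is an ordering of the primitive idempotents of $A$; (iii) $E^*_0,\ldots,E^*_d$ is an ordering of the primitive idempotents of $A^*$;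 (iv) $E_iA^*E_j$ is $0$ if $|i-j|>1$ and nonzero if $|i-j|=1$; (v) $E^*_iAE^*_j$ is $0$ if $|i-j|>1$ and nonzero if $|i-j|=1$ ($0\le i,j\le d$). ($A^*$ is just a name, not a conjugate-transpose.) $\theta_i$ (resp. $\theta^*_i$) denotes the eigenvalue of $A$ (resp. $A^*$) associated with $E_i$ (resp. $E^*_i$); these form the eigenvalue (resp. dual eigenvalue) sequence. $V$ is the irreducible left $\mathcal A$-module, of dimension $d+1$. $a_i=\mathrm{tr}(AE^*_i)$ and $a^*_i=\mathrm{tr}(A^*E_i)$ for $0\le i\le d$. Split sequences. For $0\le i\le d$ let $U_i=(E^*_0V+\cdots+E^*_iV)\cap(E_iV+\cdots+E_dV)$; it is known that $\dim U_i=1$ and that, for $1\le i\le d$, $(A-\theta_{i-1}I)(A^*-\theta^*_iI)$ acts on $U_i$ as multiplication by a nonzero scalar $\varphi_i\in\mathbb K$. The sequence $\varphi_1,\ldots,\varphi_d$ is the first split sequence of $\Phi$. The second split sequence $\phi_1,\ldots,\phi_d$ of $\Phi$ is the first split sequence of the Leonard system $(A;E_d,\ldots,E_0;A^*;E^*_0,\ldots,E^*_d)$; that is, $\phi_i$ is the scalar by which $(A-\theta_{d-i+1}I)(A^*-\theta^*_iI)$ acts on the one-dimensional space $(E^*_0V+\cdots+E^*_iV)\cap(E_{d-i}V+\cdots+E_0V)$. $S_4$ is identified with the set of linear orderings $wxyz$ of the four symbols $0,d,0^*,d^*$. The 24 bases. Fix nonzero vectors $\eta_0\in E_0V$, $\eta_d\in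 E_dV$, $\eta^*_0\in E^*_0V$, $\eta^*_d\in E^*_dV$. For $0\le i\le d$ put $\tau_i=\prod_{h=0}^{i-1}(A-\theta_hI)$, $\sigma_i=\prod_{h=d-i+1}^{d}(A-\theta_hI)$, $\tau^*_i=\prod_{h=0}^{i-1}(A^*-\theta^*_hI)$, $\sigma^*_i=\prod_{h=d-i+1}^{d}(A^*-\theta^*_hI)$ (empty products are $I$). For $g\in S_4$, $\lbrack g\rbrack$ is the ordered basis $v_0,\ldots,v_d$ of $V$ with $v_i$ as follows: $d^*00^*d$: $\tau_i\eta^*_0$; $0d^*0^*d$: $\sigma^*_{d-i}\eta_d$; $d^*0d0^*$: $\tau_{d-i}\eta^*_0$; $0d^*d0^*$: $\sigma^*_i\eta_d$; $d0^*0d^*$: $\tau^*_i\eta_0$; $0^*d0d^*$: $\sigma_{d-i}\eta^*_d$; $d0^*d^*0$: $\tau^*_{d-i}\eta_0$; $0^*dd^*0$: $\sigma_i\eta^*_d$; $dd^*00^*$: $\sigma^*_i\eta_0$; $d^*d00^*$: $\sigma_{d-i}\eta^*_0$; $dd^*0^*0$: $\sigma^*_{d-i}\eta_0$; $d^*d0^*0$: $\sigma_i\eta^*_0$; $00^*dd^*$: $\tau^*_i\eta_d$; $0^*0dd^*$: $\tau_{d-i}\eta^*_d$; $00^*d^*d$: $\tau^*_{d-i}\eta_d$; $0^*0d^*d$: $\tau_i\eta^*_d$; $d^*0^*0d$: $E_i\eta^*_0$; $0^*d^*0d$: $E_i\eta^*_d$; $d^*0^*d0$: $E_{d-i}\eta^*_0$;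 $0^*d^*d0$: $E_{d-i}\eta^*_d$; $d00^*d^*$: $E^*_i\eta_0$; $0d0^*d^*$: $E^*_i\eta_d$; $d0d^*0^*$: $E^*_{d-i}\eta_0$; $0dd^*0^*$: $E^*_{d-i}\eta_d$. (It is known that each of these sequences is a basis for $V$.) For $X\in\mathcal A$, $X^g\in\mathrm{Mat}_{d+1}(\mathbb K)$ represents $X$ with respect to $\lbrack g\rbrack=(v_0,\ldots,v_d)$: $Xv_j=\sum_{i=0}^dX^g_{ij}v_i$. In the displayed fractions, empty products of scalars equal $1$; e.g. $(\theta_i-\theta_d)\cdots(\theta_i-\theta_{i+1})$ means $\prod_{h=i+1}^d(\theta_i-\theta_h)$ and $(\theta_{i-1}-\theta_0)\cdots(\theta_{i-1}-\theta_{i-2})$ means $\prod_{h=0}^{i-2}(\theta_{i-1}-\theta_h)$. *)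

theory Defs
  imports "Jordan_Normal_Form.Matrix" "HOL-Computational_Algebra.Polynomial"
begin

definition mat_alg_iso :: "('k::field \<Rightarrow> 'a::ring_1 \<Rightarrow> 'a) \<Rightarrow> nat \<Rightarrow> ('a \<Rightarrow> 'k mat) \<Rightarrow> bool" where
  "mat_alg_iso scale n f \<longleftrightarrow>
     bij_betw f UNIV (carrier_mat n n) \<and>
     (\<forall>X Y. f (X + Y) = f X + f Y) \<and>
     (\<forall>X Y. f (X * Y) = f X * f Y) \<and>
     (\<forall>c X. f (scale c X) = c \<cdot>\<^sub>m f X) \<and>
     f 1 = 1\<^sub>m n"

locale matrix_algebra = vector_space scale
  for scale :: "'k::field \<Rightarrow> 'a::ring_1 \<Rightarrow> 'a" +
  fixes d :: nat
  assumes scale_mult_left: "scale c (X * Y) = scale c X * Y"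
    and scale_mult_right: "scale c (X * Y) = X * scale c Y"
    and iso: "\<exists>f. mat_alg_iso scale (Suc d) f"

locale irreducible_module =
  fixes act :: "'a::ring_1 \<Rightarrow> 'v::ab_group_add \<Rightarrow> 'v"
  assumes act_one: "act 1 v = v"
    and act_mult: "act (X * Y) v = act X (act Y v)"
    and act_add_left: "act (X + Y) v = act X v + act Y v"
    and act_add_right: "act X (u + v) = act X u + act X v"
    and nontrivial: "\<exists>v::'v. v \<noteq> 0"
    and irreducible:
      "\<lbrakk>0 \<in> W; \<And>u v. u \<in> W \<Longrightarrow> v \<in> W \<Longrightarrow> u + v \<in> W; \<And>X v. v \<in> W \<Longrightarrow> act X v \<in> W\<rbrakk>
        \<Longrightarrow> W = {0} \<or> W = UNIV"

text \<open>The vector space structure that an \<open>\<A>\<close>-module inherits from the scalars of \<open>\<A>\<close>.\<close>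

definition vscale :: "('k \<Rightarrow> 'a::ring_1 \<Rightarrow> 'a) \<Rightarrow> ('a \<Rightarrow> 'v \<Rightarrow> 'v) \<Rightarrow> 'k \<Rightarrow> 'v \<Rightarrow> 'v" where
  "vscale scale act c v = act (scale c 1) v"

text \<open>The trace does not depend on the chosen isomorphism.\<close>

definition alg_trace :: "('k::field \<Rightarrow> 'a::ring_1 \<Rightarrow> 'a) \<Rightarrow> nat \<Rightarrow> 'a \<Rightarrow> 'k" where
  "alg_trace scale d X =
     (THE t. \<forall>f. mat_alg_iso scale (Suc d) f \<longrightarrow> t = sum_list (diag_mat (f X)))"

definition alg_poly :: "('k::field \<Rightarrow> 'a::ring_1 \<Rightarrow> 'a) \<Rightarrow> 'k poly \<Rightarrow> 'a \<Rightarrow> 'a" where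
  "alg_poly scale p X = (\<Sum>i\<le>degree p. scale (coeff p i) (X ^ i))"

definition min_poly :: "('k::field \<Rightarrow> 'a::ring_1 \<Rightarrow> 'a) \<Rightarrow> 'a \<Rightarrow> 'k poly" where
  "min_poly scale X = (THE p. lead_coeff p = 1 \<and> alg_poly scale p X = 0 \<and>
     (\<forall>q. q \<noteq> 0 \<and> alg_poly scale q X = 0 \<longrightarrow> degree p \<le> degree q))"

definition eigenvals :: "('k::field \<Rightarrow> 'a::ring_1 \<Rightarrow> 'a) \<Rightarrow> 'a \<Rightarrow> 'k set" where
  "eigenvals scale X = {c. poly (min_poly scale X) c = 0}"

text \<open>\<^const>\<open>eigenvals\<close> only sees the eigenvalues in the ground field; that there are no others is
  the condition that the minimal polynomial splits.\<close>

definition multiplicity_free :: "('k::field \<Rightarrow> 'a::ring_1 \<Rightarrow> 'a) \<Rightarrow> nat \<Rightarrow> 'a \<Rightarrow> bool" where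
  "multiplicity_free scale d X \<longleftrightarrow>
     card (eigenvals scale X) = Suc d \<and> (\<exists>cs. min_poly scale X = (\<Prod>c\<leftarrow>cs. [:- c, 1:]))"

text \<open>The product is formed in the commutative ring of polynomials and then evaluated at \<open>X\<close>,
  because \<^const>\<open>prod\<close> is not available in the noncommutative algebra.\<close>

definition prim_idempotent :: "('k::field \<Rightarrow> 'a::ring_1 \<Rightarrow> 'a) \<Rightarrow> 'a \<Rightarrow> 'k \<Rightarrow> 'a" where
  "prim_idempotent scale X \<xi> =
     alg_poly scale (\<Prod>\<eta>\<in>eigenvals scale X - {\<xi>}. smult (1 / (\<xi> - \<eta>)) [:- \<eta>, 1:]) X"

text \<open>A Leonard system \<open>(A; E\<^sub>0,\<dots>,E\<^sub>d; A\<^sup>*; E\<^sup>*\<^sub>0,\<dots>,E\<^sup>*\<^sub>d)\<close>.  The suffix \<open>s\<close> stands for the star, and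
  only the values of \<open>E\<close> and \<open>Es\<close> on \<open>{..d}\<close> matter.\<close>

locale leonard_system = matrix_algebra scale d
  for scale :: "'k::field \<Rightarrow> 'a::ring_1 \<Rightarrow> 'a" and d :: nat +
  fixes A :: 'a and E :: "nat \<Rightarrow> 'a" and As :: 'a and Es :: "nat \<Rightarrow> 'a"
  assumes multiplicity_free: "multiplicity_free scale d A"
    and multiplicity_free_star: "multiplicity_free scale d As"
    and idempotents: "bij_betw E {..d} (prim_idempotent scale A ` eigenvals scale A)"
    and idempotents_star: "bij_betw Es {..d} (prim_idempotent scale As ` eigenvals scale As)"
    and E_As_E_zero:
      "\<lbrakk>i \<le> d; j \<le> d; \<bar>int i - int j\<bar> > 1\<rbrakk> \<Longrightarrow> E i * As * E j = 0"
    and E_As_E_nonzero: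
      "\<lbrakk>i \<le> d; j \<le> d; \<bar>int i - int j\<bar> = 1\<rbrakk> \<Longrightarrow> E i * As * E j \<noteq> 0"
    and Es_A_Es_zero:
      "\<lbrakk>i \<le> d; j \<le> d; \<bar>int i - int j\<bar> > 1\<rbrakk> \<Longrightarrow> Es i * A * Es j = 0"
    and Es_A_Es_nonzero:
      "\<lbrakk>i \<le> d; j \<le> d; \<bar>int i - int j\<bar> = 1\<rbrakk> \<Longrightarrow> Es i * A * Es j \<noteq> 0"

definition eigenvalue_seq ::
    "('k::field \<Rightarrow> 'a::ring_1 \<Rightarrow> 'a) \<Rightarrow> 'a \<Rightarrow> (nat \<Rightarrow> 'a) \<Rightarrow> nat \<Rightarrow> 'k" where
  "eigenvalue_seq scale X E i =
     (THE c. c \<in> eigenvals scale X \<and> E i = prim_idempotent scale X c)"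

definition sum_space :: "('a \<Rightarrow> 'v::ab_group_add \<Rightarrow> 'v) \<Rightarrow> (nat \<Rightarrow> 'a) \<Rightarrow> nat set \<Rightarrow> 'v set" where
  "sum_space act E J = {\<Sum>h\<in>J. act (E h) (w h) | w. True}"

definition split_space ::
    "('a \<Rightarrow> 'v::ab_group_add \<Rightarrow> 'v) \<Rightarrow> nat \<Rightarrow> (nat \<Rightarrow> 'a) \<Rightarrow> (nat \<Rightarrow> 'a) \<Rightarrow> nat \<Rightarrow> 'v set" where
  "split_space act d E Es i = sum_space act Es {0..i} \<inter> sum_space act E {i..d}"

definition first_split ::
    "('k::field \<Rightarrow> 'a::ring_1 \<Rightarrow> 'a) \<Rightarrow> ('a \<Rightarrow> 'v::ab_group_add \<Rightarrow> 'v) \<Rightarrow> nat \<Rightarrow>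
     'a \<Rightarrow> (nat \<Rightarrow> 'a) \<Rightarrow> 'a \<Rightarrow> (nat \<Rightarrow> 'a) \<Rightarrow> nat \<Rightarrow> 'k" where
  "first_split scale act d A E As Es i =
     (let \<theta> = eigenvalue_seq scale A E; \<theta>s = eigenvalue_seq scale As Es
      in THE c. \<forall>u\<in>split_space act d E Es i.
           act ((A - scale (\<theta> (i - 1)) 1) * (As - scale (\<theta>s i) 1)) u = vscale scale act c u)"

definition second_split ::
    "('k::field \<Rightarrow> 'a::ring_1 \<Rightarrow> 'a) \<Rightarrow> ('a \<Rightarrow> 'v::ab_group_add \<Rightarrow> 'v) \<Rightarrow> nat \<Rightarrow>
     'a \<Rightarrow> (nat \<Rightarrow> 'a) \<Rightarrow> 'a \<Rightarrow> (nat \<Rightarrow> 'a) \<Rightarrow> nat \<Rightarrow> 'k" where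
  "second_split scale act d A E As Es = first_split scale act d A (\<lambda>i. E (d - i)) As Es"

definition tau_op :: "('k \<Rightarrow> 'a::ring_1 \<Rightarrow> 'a) \<Rightarrow> 'a \<Rightarrow> (nat \<Rightarrow> 'k) \<Rightarrow> nat \<Rightarrow> 'a" where
  "tau_op scale X \<theta> i = (\<Prod>h\<leftarrow>[0..<i]. X - scale (\<theta> h) 1)"

definition sigma_op :: "('k \<Rightarrow> 'a::ring_1 \<Rightarrow> 'a) \<Rightarrow> nat \<Rightarrow> 'a \<Rightarrow> (nat \<Rightarrow> 'k) \<Rightarrow> nat \<Rightarrow> 'a" where
  "sigma_op scale d X \<theta> i = (\<Prod>h\<leftarrow>[d - i + 1..<d + 1]. X - scale (\<theta> h) 1)"

text \<open>The symbols \<open>0\<close>, \<open>d\<close>, \<open>0\<^sup>*\<close>, \<open>d\<^sup>*\<close>.  A linear ordering \<open>wxyz\<close> of them is written as the list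
  \<open>[w,x,y,z]\<close>; lists that are not such orderings give junk values.\<close>

datatype symb = S0 | Sd | S0s | Sds

definition basis24 ::
    "('k::field \<Rightarrow> 'a::ring_1 \<Rightarrow> 'a) \<Rightarrow> ('a \<Rightarrow> 'v::ab_group_add \<Rightarrow> 'v) \<Rightarrow> nat \<Rightarrow>
     'a \<Rightarrow> (nat \<Rightarrow> 'a) \<Rightarrow> 'a \<Rightarrow> (nat \<Rightarrow> 'a) \<Rightarrow> 'v \<Rightarrow> 'v \<Rightarrow> 'v \<Rightarrow> 'v \<Rightarrow> symb list \<Rightarrow> nat \<Rightarrow> 'v" where
  "basis24 scale act d A E As Es \<eta>0 \<eta>d \<eta>0s \<eta>ds g i =
     (let \<tau> = tau_op scale A (eigenvalue_seq scale A E);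
          \<sigma> = sigma_op scale d A (eigenvalue_seq scale A E);
          \<tau>s = tau_op scale As (eigenvalue_seq scale As Es);
          \<sigma>s = sigma_op scale d As (eigenvalue_seq scale As Es)
      in case g of
           [Sds, S0, S0s, Sd] \<Rightarrow> act (\<tau> i) \<eta>0s
         | [S0, Sds, S0s, Sd] \<Rightarrow> act (\<sigma>s (d - i)) \<eta>d
         | [Sds, S0, Sd, S0s] \<Rightarrow> act (\<tau> (d - i)) \<eta>0s
         | [S0, Sds, Sd, S0s] \<Rightarrow> act (\<sigma>s i) \<eta>d
         | [Sd, S0s, S0, Sds] \<Rightarrow> act (\<tau>s i) \<eta>0
         | [S0s, Sd, S0, Sds] \<Rightarrow> act (\<sigma> (d - i)) \<eta>ds
         | [Sd, S0s, Sds, S0] \<Rightarrow> act (\<tau>s (d - i)) \<eta>0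
         | [S0s, Sd, Sds, S0] \<Rightarrow> act (\<sigma> i) \<eta>ds
         | [Sd, Sds, S0, S0s] \<Rightarrow> act (\<sigma>s i) \<eta>0
         | [Sds, Sd, S0, S0s] \<Rightarrow> act (\<sigma> (d - i)) \<eta>0s
         | [Sd, Sds, S0s, S0] \<Rightarrow> act (\<sigma>s (d - i)) \<eta>0
         | [Sds, Sd, S0s, S0] \<Rightarrow> act (\<sigma> i) \<eta>0s
         | [S0, S0s, Sd, Sds] \<Rightarrow> act (\<tau>s i) \<eta>d
         | [S0s, S0, Sd, Sds] \<Rightarrow> act (\<tau> (d - i)) \<eta>ds
         | [S0, S0s, Sds, Sd] \<Rightarrow> act (\<tau>s (d - i)) \<eta>d
         | [S0s, S0, Sds, Sd] \<Rightarrow> act (\<tau> i) \<eta>ds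
         | [Sds, S0s, S0, Sd] \<Rightarrow> act (E i) \<eta>0s
         | [S0s, Sds, S0, Sd] \<Rightarrow> act (E i) \<eta>ds
         | [Sds, S0s, Sd, S0] \<Rightarrow> act (E (d - i)) \<eta>0s
         | [S0s, Sds, Sd, S0] \<Rightarrow> act (E (d - i)) \<eta>ds
         | [Sd, S0, S0s, Sds] \<Rightarrow> act (Es i) \<eta>0
         | [S0, Sd, S0s, Sds] \<Rightarrow> act (Es i) \<eta>d
         | [Sd, S0, Sds, S0s] \<Rightarrow> act (Es (d - i)) \<eta>0
         | [S0, Sd, Sds, S0s] \<Rightarrow> act (Es (d - i)) \<eta>d
         | _ \<Rightarrow> undefined)"

definition rep_matrix ::
    "('k::field \<Rightarrow> 'a::ring_1 \<Rightarrow> 'a) \<Rightarrow> ('a \<Rightarrow> 'v::ab_group_add \<Rightarrow> 'v) \<Rightarrow> nat \<Rightarrow> 'a \<Rightarrow> (nat \<Rightarrow> 'v) \<Rightarrow> 'k mat"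
  where
  "rep_matrix scale act d X v =
     (THE M. M \<in> carrier_mat (Suc d) (Suc d) \<and>
        (\<forall>j\<le>d. act X (v j) = (\<Sum>i\<le>d. vscale scale act (M $$ (i, j)) (v i))))"

text \<open>The matrix with entries \<open>l i\<close> at \<open>(i, i - 1)\<close>, \<open>a i\<close> at \<open>(i, i)\<close>, \<open>u i\<close> at \<open>(i - 1, i)\<close>, and
  zeros elsewhere.\<close>

definition tridiag :: "nat \<Rightarrow> (nat \<Rightarrow> 'k::zero) \<Rightarrow> (nat \<Rightarrow> 'k) \<Rightarrow> (nat \<Rightarrow> 'k) \<Rightarrow> 'k mat" where
  "tridiag d l a u = mat (Suc d) (Suc d)
     (\<lambda>(i, j). if i = j + 1 then l i else if i = j then a i else if j = i + 1 then u j else 0)"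

end

theory Submission
  imports Defs
begin

text \<open>Write \<open>u i = \<tau>\<^sub>i \<eta>\<^sup>*\<^sub>0\<close>. Tridiagonality forces \<open>u i\<close> to span the split space \<open>U\<^sub>i\<close>, and
  \<open>A\<close>, \<open>A\<^sup>*\<close> act on the basis \<open>u\<close> as lower and upper bidiagonal matrices in which the first
  split sequence appears by its very definition. The other split bases are of this form for the
  systems obtained by reversing the order of the \<open>E\<^sub>i\<close>, reversing that of the \<open>E\<^sup>*\<^sub>i\<close>, and
  exchanging \<open>A\<close> with \<open>A\<^sup>*\<close>, so the point is to express the first split sequences of these
  relatives through the two given ones. Exchanging \<open>A\<close> and \<open>A\<^sup>*\<close> leaves the first split
  sequence unchanged, which is seen by following \<open>E\<^sub>0 \<tau>\<^sup>*\<^sub>i(A\<^sup>*) E\<^sub>0\<close> in both pictures;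
  reversing both orders and exchanging turns \<open>U\<^sub>i\<close> into \<open>U\<^bsub>d-i\<^esub>\<close> and so reverses the sequence.
  For the eigenbases \<open>E\<^sub>i \<eta>\<^sup>*\<^sub>0\<close>, comparing the \<open>E\<^bsub>i-1\<^esub>\<close>-components of \<open>A\<^sup>* u i\<close> computed in
  two ways gives the superdiagonal of \<open>A\<^sup>*\<close>; the subdiagonal is the superdiagonal of the
  reversed system.\<close>

section \<open>Operators with simple spectrum\<close>

text \<open>This is the product of the \<open>A - c h\<close> over \<open>h < i\<close>, applied to
  \<open>x\<close>. With \<open>c = \<theta>\<close> it gives the action of
  \<open>\<tau>\<^sub>i\<close>, and with \<open>c h = \<theta> (d - h)\<close> that of
  \<open>\<sigma>\<^sub>i\<close>.\<close>

primrec newton :: "('k \<Rightarrow> 'v \<Rightarrow> 'v::ab_group_add) \<Rightarrow> ('v \<Rightarrow> 'v) \<Rightarrow> (nat \<Rightarrow> 'k) \<Rightarrow> nat \<Rightarrow> 'v \<Rightarrow> 'v" where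
  "newton smul A c 0 x = x"
| "newton smul A c (Suc i) x = A (newton smul A c i x) - smul (c i) (newton smul A c i x)"

text \<open>\<open>split_part\<close> is the space \<open>U\<^sub>i\<close>, and \<open>split_scalar\<close> the first split sequence, with \<open>P\<close>, \<open>Q\<close> the
  actions of the \<open>E\<^sub>i\<close>, \<open>E\<^sup>*\<^sub>i\<close>.\<close>

definition split_part :: "nat \<Rightarrow> (nat \<Rightarrow> 'v \<Rightarrow> 'v::zero) \<Rightarrow> (nat \<Rightarrow> 'v \<Rightarrow> 'v) \<Rightarrow> nat \<Rightarrow> 'v set" where
  "split_part d P Q i = {x. (\<forall>j<i. P j x = 0) \<and> (\<forall>j\<le>d. i < j \<longrightarrow> Q j x = 0)}"

definition split_scalar :: "('k \<Rightarrow> 'v \<Rightarrow> 'v::ab_group_add) \<Rightarrow> nat \<Rightarrow>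
    ('v \<Rightarrow> 'v) \<Rightarrow> (nat \<Rightarrow> 'v \<Rightarrow> 'v) \<Rightarrow> (nat \<Rightarrow> 'k) \<Rightarrow> ('v \<Rightarrow> 'v) \<Rightarrow> (nat \<Rightarrow> 'v \<Rightarrow> 'v) \<Rightarrow> (nat \<Rightarrow> 'k) \<Rightarrow>
    nat \<Rightarrow> 'k" where
  "split_scalar smul d A P \<theta> B Q \<theta>s i =
     (THE c. \<forall>u\<in>split_part d P Q i.
        A (B u - smul (\<theta>s i) u) - smul (\<theta> (i - 1)) (B u - smul (\<theta>s i) u) = smul c u)"

lemma split_part_cong:
  assumes "\<And>j. j \<le> d \<Longrightarrow> P j = P' j" "\<And>j. j \<le> d \<Longrightarrow> Q j = Q' j" "i \<le> d"
  shows "split_part d P Q i = split_part d P' Q' i"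
  using assms by (auto simp: split_part_def)

lemma split_scalar_cong:
  assumes "\<And>j. j \<le> d \<Longrightarrow> P j = P' j" "\<And>j. j \<le> d \<Longrightarrow> Q j = Q' j"
    and "\<And>j. j \<le> d \<Longrightarrow> \<theta> j = \<theta>' j" "\<And>j. j \<le> d \<Longrightarrow> \<theta>s j = \<theta>s' j" "i \<le> d"
  shows "split_scalar smul d A P \<theta> B Q \<theta>s i = split_scalar smul d A P' \<theta>' B Q' \<theta>s' i"
  using assms split_part_cong[of d P P' Q Q' i] by (simp add: split_scalar_def)

text \<open>What a multiplicity-free element and its ordered primitive idempotents amount to as
  operators on \<open>V\<close>. The assumption \<open>rank_one\<close> expresses, without
  dimensions, that each eigenspace is a line.\<close>

locale spectral_operator = vector_space smul
  for smul :: "'k::field \<Rightarrow> 'v::ab_group_add \<Rightarrow> 'v" (infixr "\<star>" 75) +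
  fixes d :: nat and A :: "'v \<Rightarrow> 'v" and P :: "nat \<Rightarrow> 'v \<Rightarrow> 'v" and \<theta> :: "nat \<Rightarrow> 'k"
  assumes A_add: "A (x + y) = A x + A y"
    and A_smul: "A (c \<star> x) = c \<star> A x"
    and P_add: "P i (x + y) = P i x + P i y"
    and P_smul: "P i (c \<star> x) = c \<star> P i x"
    and P_P: "\<lbrakk>i \<le> d; j \<le> d\<rbrakk> \<Longrightarrow> P i (P j x) = (if i = j then P i x else 0)"
    and P_sum: "(\<Sum>i\<le>d. P i x) = x"
    and A_P: "i \<le> d \<Longrightarrow> A (P i x) = \<theta> i \<star> P i x"
    and inj_eigenvalues: "inj_on \<theta> {..d}"
    and P_nz: "i \<le> d \<Longrightarrow> \<exists>x. P i x \<noteq> 0"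
    and rank_one: "\<lbrakk>i \<le> d; P i x \<noteq> 0\<rbrakk> \<Longrightarrow> \<exists>c. P i y = c \<star> P i x"
begin

lemma A_linear: "A 0 = 0" "A (x - y) = A x - A y" "A (sum f S) = (\<Sum>i\<in>S. A (f i))"
proof -
  interpret additive A by unfold_locales (rule A_add)
  show "A 0 = 0" "A (x - y) = A x - A y" "A (sum f S) = (\<Sum>i\<in>S. A (f i))"
    by (rule zero diff sum)+
qed

lemma P_linear: "P i 0 = 0" "P i (x - y) = P i x - P i y" "P i (sum f S) = (\<Sum>j\<in>S. P i (f j))"
proof -
  interpret additive "P i" by unfold_locales (rule P_add)
  show "P i 0 = 0" "P i (x - y) = P i x - P i y" "P i (sum f S) = (\<Sum>j\<in>S. P i (f j))"
    by (rule zero diff sum)+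
qed

lemma eq_0I: "x = 0" if "\<And>i. i \<le> d \<Longrightarrow> P i x = 0"
  using P_sum[of x] that by simp

lemma P_A: "P i (A x) = \<theta> i \<star> P i x" if "i \<le> d"
proof -
  have "P i (A x) = P i (A (\<Sum>j\<le>d. P j x))" by (simp add: P_sum)
  also have "\<dots> = (\<Sum>j\<le>d. if i = j then \<theta> i \<star> P i x else 0)"
    unfolding A_linear P_linear by (rule sum.cong) (use that in \<open>auto simp: A_P P_smul P_P\<close>)
  finally show ?thesis using that by simp
qed

lemma P_newton: "P j (newton smul A c i x) = (\<Prod>h<i. \<theta> j - c h) \<star> P j x" if "j \<le> d"
  using that by (induction i) (auto simp: P_linear P_A P_smul scale_left_diff_distrib algebra_simps)

lemma newton_add: "newton smul A c i (x + y) = newton smul A c i x + newton smul A c i y"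
  by (induction i) (auto simp: A_add scale_right_distrib)

lemma newton_smul: "newton smul A c i (b \<star> x) = b \<star> newton smul A c i x"
  by (induction i) (auto simp: A_smul scale_right_diff_distrib mult.commute)

text \<open>The factors are polynomials in \<open>A\<close> and commute, so the last one may also be
  applied first.\<close>

lemma newton_Suc_right:
  "newton smul A c (Suc i) x = newton smul A c i (A x - c i \<star> x)"
proof -
  have "newton smul A c i (A x) = A (newton smul A c i x)" for x
    by (induction i) (auto simp: A_linear A_smul)
  moreover have "newton smul A c i (x - y) = newton smul A c i x - newton smul A c i y" for x y
    by (induction i) (auto simp: A_linear scale_right_diff_distrib)
  ultimately show ?thesis by (simp add: newton_smul)
qed

lemma prod_diff_nz: "(\<Prod>h<i. \<theta> j - \<theta> h) \<noteq> 0" if "i \<le> j" "j \<le> d"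
  using that inj_eigenvalues by (force simp: inj_on_def)

lemma reverse: "spectral_operator smul d A (\<lambda>i. P (d - i)) (\<lambda>i. \<theta> (d - i))"
proof unfold_locales
  show "(\<Sum>i\<le>d. P (d - i) x) = x" for x
    using P_sum[of x] sum.nat_diff_reindex[of "\<lambda>i. P i x" "Suc d"] by (simp add: lessThan_Suc_atMost)
  show "inj_on (\<lambda>i. \<theta> (d - i)) {..d}"
  proof (rule inj_onI)
    fix i j assume "i \<in> {..d}" "j \<in> {..d}" "\<theta> (d - i) = \<theta> (d - j)"
    moreover from this have "d - i = d - j"
      by (intro inj_onD[OF inj_eigenvalues]) auto
    ultimately show "i = j" by simp
  qed
qed (use A_add A_smul P_add P_smul P_P A_P P_nz rank_one in auto)

end

section \<open>Pairs of operators acting irreducibly tridiagonally on each other's eigenspaces\<close>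

text \<open>The assumptions are symmetric under exchanging the two operators and under reversing
  either ordering. Every result below therefore holds for all eight relatives of a pair.\<close>

locale leonard_operators =
  A: spectral_operator smul d A P \<theta> + B: spectral_operator smul d B Q \<theta>s
  for smul :: "'k::field \<Rightarrow> 'v::ab_group_add \<Rightarrow> 'v" (infixr "\<star>" 75)
    and d A P \<theta> B Q \<theta>s +
  assumes P_B_P: "\<lbrakk>i \<le> d; j \<le> d; i + 1 < j \<or> j + 1 < i\<rbrakk> \<Longrightarrow> P i (B (P j x)) = 0"
    and Q_A_Q: "\<lbrakk>i \<le> d; j \<le> d; i + 1 < j \<or> j + 1 < i\<rbrakk> \<Longrightarrow> Q i (A (Q j x)) = 0"
    and P_B_P_nz: "\<lbrakk>i \<le> d; j \<le> d; i = j + 1 \<or> j = i + 1\<rbrakk> \<Longrightarrow> \<exists>x. P i (B (P j x)) \<noteq> 0"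
    and Q_A_Q_nz: "\<lbrakk>i \<le> d; j \<le> d; i = j + 1 \<or> j = i + 1\<rbrakk> \<Longrightarrow> \<exists>x. Q i (A (Q j x)) \<noteq> 0"

lemma (in leonard_operators) dual: "leonard_operators smul d B Q \<theta>s A P \<theta>"
  using P_B_P Q_A_Q P_B_P_nz Q_A_Q_nz by unfold_locales

lemma (in leonard_operators) reverse_left:
  "leonard_operators smul d A (\<lambda>i. P (d - i)) (\<lambda>i. \<theta> (d - i)) B Q \<theta>s"
proof -
  interpret A': spectral_operator smul d A "\<lambda>i. P (d - i)" "\<lambda>i. \<theta> (d - i)" by (rule A.reverse)
  show ?thesis
    by unfold_locales (intro P_B_P Q_A_Q P_B_P_nz Q_A_Q_nz; linarith)+
qed

context leonard_operators
begin

lemma reverse_right: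
  "leonard_operators smul d A P \<theta> B (\<lambda>i. Q (d - i)) (\<lambda>i. \<theta>s (d - i))"
  by (rule leonard_operators.dual[OF leonard_operators.reverse_left[OF dual]])

lemma Q_A_sum: "Q j (A w) = (\<Sum>l\<le>d. Q j (A (Q l w)))"
proof -
  have "Q j (A w) = Q j (A (\<Sum>l\<le>d. Q l w))" by (simp add: B.P_sum)
  also have "\<dots> = (\<Sum>l\<le>d. Q j (A (Q l w)))" by (simp only: A.A_linear B.P_linear)
  finally show ?thesis .
qed

text \<open>By \<open>Q_A_Q\<close> only components \<open>Q m w\<close> with \<open>m\<close> at
  distance at most one from \<open>j\<close> contribute to \<open>Q j (A w)\<close>, and the third
  assumption removes those with \<open>m \<noteq> l\<close>.\<close>

lemma Q_A_single:
  assumes "j \<le> d" "l \<le> d" "\<And>m. \<lbrakk>m \<le> d; m \<noteq> l; m \<le> j + 1; j \<le> m + 1\<rbrakk> \<Longrightarrow> Q m w = 0"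
  shows "Q j (A w) = Q j (A (Q l w))"
proof -
  have "Q j (A (Q m w)) = 0" if "m \<le> d" "m \<noteq> l" for m
    using assms that Q_A_Q[of j m w] by (cases "m \<le> j + 1 \<and> j \<le> m + 1") (auto simp: A.A_linear B.P_linear)
  then have "Q j (A w) = (\<Sum>m\<in>{l}. Q j (A (Q m w)))"
    unfolding Q_A_sum[of j w] by (intro sum.mono_neutral_right) (use assms in auto)
  then show ?thesis by simp
qed

text \<open>The locale gives nonvanishing for some vector; as the range of \<open>Q j\<close> is a
  line, it extends to every nonzero vector there.\<close>

lemma Q_A_Q_nz': "Q i (A (Q j w)) \<noteq> 0"
  if ij: "i \<le> d" "j \<le> d" "i = j + 1 \<or> j = i + 1" and nz: "Q j w \<noteq> 0"
proof
  assume 0: "Q i (A (Q j w)) = 0"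
  obtain x where x: "Q i (A (Q j x)) \<noteq> 0" using Q_A_Q_nz[OF ij] by blast
  obtain c where "Q j x = c \<star> Q j w" using B.rank_one[OF ij(2) nz] by blast
  with x 0 show False by (simp add: A.A_smul B.P_smul)
qed

text \<open>Multiplying by a linear factor in \<open>A\<close> raises the top index of the \<open>Q\<close>-support by exactly one.\<close>

lemma Q_newton:
  assumes "m + i \<le> d" "\<And>j. \<lbrakk>m < j; j \<le> d\<rbrakk> \<Longrightarrow> Q j x = 0" "Q m x \<noteq> 0"
  shows "(\<forall>j\<le>d. m + i < j \<longrightarrow> Q j (newton smul A c i x) = 0) \<and> Q (m + i) (newton smul A c i x) \<noteq> 0"
  using assms(1)
proof (induction i)
  case 0
  then show ?case using assms(2,3) by simp
next
  case (Suc i)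
  let ?w = "newton smul A c i x"
  have IH: "\<And>j. j \<le> d \<Longrightarrow> m + i < j \<Longrightarrow> Q j ?w = 0" "Q (m + i) ?w \<noteq> 0" using Suc by auto
  have eq: "Q j (newton smul A c (Suc i) x) = Q j (A (Q (m + i) ?w))" if "m + i < j" "j \<le> d" for j
    using that IH by (simp add: B.P_linear B.P_smul) (rule Q_A_single; use Suc.prems in auto)
  show ?case
  proof (intro conjI allI impI)
    show "Q j (newton smul A c (Suc i) x) = 0" if "j \<le> d" "m + Suc i < j" for j
      using eq[of j] that Q_A_Q[of j "m + i"] by simp
    show "Q (m + Suc i) (newton smul A c (Suc i) x) \<noteq> 0"
      using eq[of "m + Suc i"] Q_A_Q_nz'[of "m + Suc i" "m + i" ?w] IH(2) Suc.prems by simp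
  qed
qed

text \<open>This intersection being zero is what bounds the dimension of the split spaces. If
  \<open>m < k\<close> is the top index of the \<open>Q\<close>-support of a nonzero
  \<open>x\<close>, the product of the \<open>A - \<theta> h\<close> over
  \<open>k \<le> h \<le> d\<close> kills \<open>x\<close>, because the \<open>P\<close>-support lies
  in that range. By \<open>Q_newton\<close> the same product moves the top index to
  \<open>m + (d - k + 1) \<le> d\<close> with a nonzero component there.\<close>

lemma split_trivial:
  assumes "\<And>j. j < k \<Longrightarrow> P j x = 0" "\<And>j. \<lbrakk>k \<le> j; j \<le> d\<rbrakk> \<Longrightarrow> Q j x = 0" "k \<le> d"
  shows "x = 0"
proof (rule ccontr)
  assume "x \<noteq> 0"
  define S where "S = {m. m \<le> d \<and> Q m x \<noteq> 0}"
  have "S \<noteq> {}" using \<open>x \<noteq> 0\<close> B.eq_0I[of x] by (auto simp: S_def)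
  moreover have fin: "finite S" by (auto simp: S_def)
  ultimately have "Max S \<in> S" by (rule Max_in[rotated])
  define m where "m = Max S"
  have m: "m \<le> d" "Q m x \<noteq> 0" using \<open>Max S \<in> S\<close> by (auto simp: S_def m_def)
  have top: "Q j x = 0" if "m < j" "j \<le> d" for j
  proof (rule ccontr)
    assume "Q j x \<noteq> 0"
    then have "j \<le> Max S" using that by (intro Max_ge fin) (simp add: S_def)
    with that show False by (simp add: m_def)
  qed
  have "m < k" using m assms(2) by (meson not_le)
  let ?w = "newton smul A (\<lambda>h. \<theta> (k + h)) (d - k + 1) x"
  have "?w = 0"
  proof (rule A.eq_0I)
    fix j assume "j \<le> d"
    show "P j ?w = 0"
    proof (cases "j < k")
      case True
      then show ?thesis using assms(1) \<open>j \<le> d\<close> by (simp only: A.P_newton) simp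
    next
      case False
      then have "(\<Prod>h<d - k + 1. \<theta> j - \<theta> (k + h)) = 0"
        using \<open>j \<le> d\<close> by (intro prod_zero) (auto intro!: bexI[of _ "j - k"])
      then show ?thesis using \<open>j \<le> d\<close> by (simp only: A.P_newton) simp
    qed
  qed
  moreover have "Q (m + (d - k + 1)) ?w \<noteq> 0"
    by (rule Q_newton[THEN conjunct2]) (use top m \<open>m < k\<close> assms(3) in auto)
  ultimately show False by (simp add: B.P_linear)
qed

end

text \<open>Linear independence is included because it makes the representing matrix unique. The
  case distinctions match the ends of a tridiagonal matrix: only \<open>l 1\<close>, ...,
  \<open>l d\<close> and \<open>u 1\<close>, ..., \<open>u d\<close> enter.\<close>

definition represents :: "('k \<Rightarrow> 'v \<Rightarrow> 'v::ab_group_add) \<Rightarrow> nat \<Rightarrow> (nat \<Rightarrow> 'v) \<Rightarrow> ('v \<Rightarrow> 'v) \<Rightarrow>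
    (nat \<Rightarrow> 'k::field) \<Rightarrow> (nat \<Rightarrow> 'k) \<Rightarrow> (nat \<Rightarrow> 'k) \<Rightarrow> bool" where
  "represents smul d v X l a u \<longleftrightarrow>
     (\<forall>c. (\<Sum>i\<le>d. smul (c i) (v i)) = 0 \<longrightarrow> (\<forall>i\<le>d. c i = 0)) \<and>
     (\<forall>j\<le>d. X (v j) = (if j < d then smul (l (Suc j)) (v (Suc j)) else 0) + smul (a j) (v j)
        + (if 0 < j then smul (u j) (v (j - 1)) else 0))"

lemma represents_cong:
  assumes "represents smul d v X l a u"
    and "\<And>i. i \<le> d \<Longrightarrow> v i = v' i" "\<And>i. i \<le> d \<Longrightarrow> a i = a' i"
    and "\<And>i. 1 \<le> i \<Longrightarrow> i \<le> d \<Longrightarrow> l i = l' i" "\<And>i. 1 \<le> i \<Longrightarrow> i \<le> d \<Longrightarrow> u i = u' i"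
  shows "represents smul d v' X l' a' u'"
  using assms unfolding represents_def by (auto simp: Suc_le_eq)

text \<open>The new entry at \<open>(i, i - 1)\<close> is the old one at
  \<open>(d - i, d - i + 1)\<close>, so the two off-diagonals trade places and their index becomes
  \<open>d - i + 1\<close>.\<close>

lemma represents_reverse:
  assumes "represents smul d v X l a u"
  shows "represents smul d (\<lambda>i. v (d - i)) X (\<lambda>i. u (d - i + 1)) (\<lambda>i. a (d - i)) (\<lambda>i. l (d - i + 1))"
  unfolding represents_def
proof (intro conjI allI impI)
  fix c i assume 0: "(\<Sum>i\<le>d. smul (c i) (v (d - i))) = 0" and "i \<le> d"
  have "(\<Sum>i\<le>d. smul (c (d - i)) (v i)) = (\<Sum>i\<le>d. smul (c (d - (d - i))) (v (d - i)))"
    using sum.nat_diff_reindex[of "\<lambda>i. smul (c (d - i)) (v i)" "Suc d"]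
    by (simp add: lessThan_Suc_atMost)
  also have "\<dots> = 0" using 0 by simp
  finally have "\<forall>i\<le>d. c (d - i) = 0"
    using assms unfolding represents_def by (blast dest: spec[of _ "\<lambda>i. c (d - i)"])
  then show "c i = 0" using \<open>i \<le> d\<close> by (metis diff_diff_cancel diff_le_self)
next
  fix j assume "j \<le> d"
  then have "X (v (d - j)) = (if d - j < d then smul (l (Suc (d - j))) (v (Suc (d - j))) else 0)
      + smul (a (d - j)) (v (d - j)) + (if 0 < d - j then smul (u (d - j)) (v (d - j - 1)) else 0)"
    using assms by (simp add: represents_def)
  moreover have "d - (j - 1) = Suc (d - j)" "d - j + 1 = Suc (d - j)" if "0 < j"
    using that \<open>j \<le> d\<close> by simp_all
  moreover have "d - Suc j + 1 = d - j" "d - j - 1 = d - Suc j" if "j < d" using that by simp_all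
  moreover have "d - j < d \<longleftrightarrow> 0 < j" "0 < d - j \<longleftrightarrow> j < d" using \<open>j \<le> d\<close> by auto
  ultimately show "X (v (d - j)) = (if j < d then smul (u (d - Suc j + 1)) (v (d - Suc j)) else 0)
     + smul (a (d - j)) (v (d - j)) + (if 0 < j then smul (l (d - j + 1)) (v (d - (j - 1))) else 0)"
    by (simp only: add_ac cong: if_cong)
qed

section \<open>The split basis generated by a vector in the range of \<open>Q 0\<close>\<close>

context leonard_operators
begin

declare newton.simps(2) [simp del]

context
  fixes y :: 'v
  assumes y: "Q 0 y = y" "y \<noteq> 0"
begin

lemma Q_y: "Q j y = (if j = 0 then y else 0)" if "j \<le> d"
  using that y(1) B.P_P[of j 0 y] by auto

lemma Q_newton_y:
  assumes "i \<le> d"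
  shows "\<And>j. \<lbrakk>j \<le> d; i < j\<rbrakk> \<Longrightarrow> Q j (newton smul A c i y) = 0" "Q i (newton smul A c i y) \<noteq> 0"
  using Q_newton[of 0 i y c] assms Q_y y(2) by auto

lemma newton_y_nz: "newton smul A c i y \<noteq> 0" if "i \<le> d"
  using Q_newton_y(2)[OF that, of c] by (auto simp: B.P_linear)

text \<open>Otherwise the product of the \<open>A - \<theta> h\<close> over the other \<open>d\<close> eigenvalues would kill \<open>y\<close>.\<close>

lemma P_y_nz: "P j y \<noteq> 0" if "j \<le> d"
proof
  assume 0: "P j y = 0"
  define c where "c h = \<theta> (if h < j then h else Suc h)" for h
  have "newton smul A c d y = 0"
  proof (rule A.eq_0I)
    fix l assume "l \<le> d"
    show "P l (newton smul A c d y) = 0"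
    proof (cases "l = j")
      case False
      then have "(\<Prod>h<d. \<theta> l - c h) = 0"
        using \<open>l \<le> d\<close> \<open>j \<le> d\<close>
        by (intro prod_zero bexI[of _ "if l < j then l else l - 1"]) (auto simp: c_def)
      then show ?thesis using \<open>l \<le> d\<close> by (simp add: A.P_newton)
    qed (use 0 \<open>j \<le> d\<close> in \<open>simp add: A.P_newton\<close>)
  qed
  then show False using newton_y_nz by blast
qed

abbreviation u where "u i \<equiv> newton smul A \<theta> i y"

lemma P_u: "P j (u i) = (\<Prod>h<i. \<theta> j - \<theta> h) \<star> P j y" if "j \<le> d"
  using that by (rule A.P_newton)

lemma P_u_0: "P j (u i) = 0" if "j < i" "j \<le> d"
proof -
  have "(\<Prod>h<i. \<theta> j - \<theta> h) = 0" using that by (intro prod_zero) auto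
  then show ?thesis using that by (simp add: P_u)
qed

lemma P_u_nz: "P i (u i) \<noteq> 0" if "i \<le> d"
  using that P_y_nz A.prod_diff_nz[of i i] by (simp add: P_u del: prod_zero_iff)

lemma u_in_split_part: "u i \<in> split_part d P Q i" if "i \<le> d"
  using that P_u_0 Q_newton_y(1) by (auto simp: split_part_def)

text \<open>The split space is spanned by \<open>u i\<close>: subtracting the multiple of
  \<open>u i\<close> with the same \<open>Q i\<close>-component leaves a vector to which
  \<open>split_trivial\<close> applies with \<open>k = i\<close>.\<close>

lemma split_part_eq: "\<exists>c. x = c \<star> u i" if x: "x \<in> split_part d P Q i" and i: "i \<le> d"
proof -
  obtain c where c: "Q i x = c \<star> Q i (u i)"
    using B.rank_one[OF i Q_newton_y(2)[OF i]] by blast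
  have "x - c \<star> u i = 0"
  proof (rule split_trivial)
    show "P j (x - c \<star> u i) = 0" if "j < i" for j
      using x i that P_u_0 by (auto simp: split_part_def A.P_linear A.P_smul)
    show "Q j (x - c \<star> u i) = 0" if "i \<le> j" "j \<le> d" for j
      using that c x i Q_newton_y(1)[OF i]
      by (cases "i = j") (auto simp: split_part_def B.P_linear B.P_smul)
  qed (rule i)
  then show ?thesis by auto
qed

lemma A_u: "A (u i) = \<theta> i \<star> u i + u (Suc i)"
  by (simp add: newton.simps)

text \<open>All components \<open>P j (u d)\<close> with \<open>j < d\<close> vanish, so
  \<open>u d\<close> is an eigenvector and the basis ends here.\<close>

lemma A_u_top: "A (u d) = \<theta> d \<star> u d"
proof -
  have "u d = (\<Sum>j\<in>{d}. P j (u d))"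
    by (subst sum.mono_neutral_left[of "{..d}"]) (auto simp: A.P_sum P_u_0)
  then show ?thesis using A.A_P[of d "u d"] by simp
qed

text \<open>By tridiagonality \<open>B\<close> lowers the least index of the
  \<open>P\<close>-support by at most one, while subtracting \<open>\<theta>s i\<close> removes the
  top \<open>Q\<close>-component. So \<open>B - \<theta>s i\<close> maps the split space of index
  \<open>i\<close> into that of index \<open>i - 1\<close>.\<close>

lemma B_u_lower:
  assumes i: "1 \<le> i" "i \<le> d"
  shows "B (u i) - \<theta>s i \<star> u i \<in> split_part d P Q (i - 1)"
proof -
  have "P j (B (u i)) = 0" if "j < i - 1" for j
  proof -
    have "P j (B (u i)) = P j (B (P j (u i)))"
      by (rule leonard_operators.Q_A_single[OF dual]) (use that i P_u_0 in auto)
    then show ?thesis using that i P_u_0[of j i] by (simp add: A.P_linear B.A_linear)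
  qed
  moreover have "Q j (B (u i)) = \<theta>s i \<star> Q j (u i)" if "j \<le> d" "i - 1 < j" for j
    using that i Q_newton_y(1)[of i j] by (cases "i = j") (auto simp: B.P_A)
  ultimately show ?thesis
    using i P_u_0 by (auto simp: split_part_def A.P_linear A.P_smul B.P_linear B.P_smul)
qed

lemma B_u_exists: "\<exists>c. B (u i) - \<theta>s i \<star> u i = c \<star> u (i - 1)" if "1 \<le> i" "i \<le> d"
  using split_part_eq[OF B_u_lower[OF that]] that by simp

text \<open>Applying \<open>A - \<theta> (i - 1)\<close> to \<open>c \<star> u (i - 1)\<close>
  returns \<open>c \<star> u i\<close>. Hence the coefficient of the lowering step is the scalar in
  the definition, unique because \<open>u i\<close> is nonzero.\<close>

lemma split_scalar_eqI:
  assumes i: "1 \<le> i" "i \<le> d" and c: "B (u i) - \<theta>s i \<star> u i = c \<star> u (i - 1)"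
  shows "split_scalar smul d A P \<theta> B Q \<theta>s i = c"
  unfolding split_scalar_def
proof (rule the_equality)
  have Suc: "A (u (i - 1)) - \<theta> (i - 1) \<star> u (i - 1) = u i"
    using A_u[of "i - 1"] i by simp
  have "A (B (u i) - \<theta>s i \<star> u i) - \<theta> (i - 1) \<star> (B (u i) - \<theta>s i \<star> u i)
      = c \<star> (A (u (i - 1)) - \<theta> (i - 1) \<star> u (i - 1))"
    by (simp add: c A.A_smul A.scale_right_diff_distrib mult.commute)
  also have "\<dots> = c \<star> u i" by (simp only: Suc)
  finally have *: "A (B (u i) - \<theta>s i \<star> u i) - \<theta> (i - 1) \<star> (B (u i) - \<theta>s i \<star> u i) = c \<star> u i" .
  show "\<forall>x\<in>split_part d P Q i. A (B x - \<theta>s i \<star> x) - \<theta> (i - 1) \<star> (B x - \<theta>s i \<star> x) = c \<star> x"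
  proof
    fix x assume "x \<in> split_part d P Q i"
    then obtain b where b: "x = b \<star> u i" using split_part_eq i by blast
    have "A (B x - \<theta>s i \<star> x) - \<theta> (i - 1) \<star> (B x - \<theta>s i \<star> x)
        = b \<star> (A (B (u i) - \<theta>s i \<star> u i) - \<theta> (i - 1) \<star> (B (u i) - \<theta>s i \<star> u i))"
      by (simp add: b A.A_smul B.A_smul A.A_linear A.scale_right_diff_distrib mult.commute)
    then show "A (B x - \<theta>s i \<star> x) - \<theta> (i - 1) \<star> (B x - \<theta>s i \<star> x) = c \<star> x"
      by (simp only: *) (simp add: b mult.commute)
  qed
  fix c' assume "\<forall>x\<in>split_part d P Q i.
    A (B x - \<theta>s i \<star> x) - \<theta> (i - 1) \<star> (B x - \<theta>s i \<star> x) = c' \<star> x"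
  then have "c' \<star> u i = c \<star> u i" using u_in_split_part[of i] i * by simp
  then show "c' = c" using newton_y_nz[of i \<theta>] i by simp
qed

abbreviation \<psi> where "\<psi> i \<equiv> split_scalar smul d A P \<theta> B Q \<theta>s i"

lemma B_u: "B (u i) = \<theta>s i \<star> u i + \<psi> i \<star> u (i - 1)" if "1 \<le> i" "i \<le> d"
  using B_u_exists[OF that] split_scalar_eqI[OF that] by (metis add.commute diff_add_cancel)

lemma B_u_0: "B (u 0) = \<theta>s 0 \<star> u 0"
  using B.A_P[of 0 y] y(1) by simp

text \<open>Were it zero, \<open>B (u i)\<close> would be a multiple of \<open>u i\<close> and have
  no \<open>P (i - 1)\<close>-component, but \<open>B\<close> carries the nonzero vector
  \<open>P i (u i)\<close> to one with such a component.\<close>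

lemma split_scalar_nz: "\<psi> i \<noteq> 0" if i: "1 \<le> i" "i \<le> d"
proof
  assume "\<psi> i = 0"
  then have "P (i - 1) (B (u i)) = 0" using B_u[OF i] i P_u_0[of "i - 1" i] by (simp add: A.P_smul)
  moreover have "P (i - 1) (B (u i)) = P (i - 1) (B (P i (u i)))"
    by (rule leonard_operators.Q_A_single[OF dual]) (use i P_u_0 in auto)
  moreover have "P (i - 1) (B (P i (u i))) \<noteq> 0"
    by (rule leonard_operators.Q_A_Q_nz'[OF dual]) (use i P_u_nz[of i] in auto)
  ultimately show False by simp
qed

text \<open>The family is triangular for the \<open>P i\<close>: \<open>P i (u j)\<close> vanishes
  for \<open>j > i\<close> and \<open>P i (u i)\<close> does not. Coefficients are therefore
  eliminated from the lowest index up.\<close>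

lemma u_independent:
  assumes "(\<Sum>i\<le>d. c i \<star> u i) = 0" "i \<le> d"
  shows "c i = 0"
  using assms(2)
proof (induction i rule: less_induct)
  case (less i)
  have "P i (c j \<star> u j) = 0" if "j \<le> d" "j \<noteq> i" for j
    using that less P_u_0[of i j] by (cases "j < i") (auto simp: A.P_smul A.P_linear)
  then have "(\<Sum>j\<in>{i}. P i (c j \<star> u j)) = (\<Sum>j\<le>d. P i (c j \<star> u j))"
    using less.prems by (intro sum.mono_neutral_left) auto
  also have "\<dots> = P i (\<Sum>j\<le>d. c j \<star> u j)" by (simp only: A.P_linear)
  finally have "c i \<star> P i (u i) = 0" by (simp add: assms(1) A.P_linear A.P_smul)
  then show ?case using P_u_nz less.prems by simp
qed

lemma split_basis_represents:
  "represents smul d (\<lambda>i. newton smul A \<theta> i y) A (\<lambda>i. 1) \<theta> (\<lambda>i. 0)"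
  "represents smul d (\<lambda>i. newton smul A \<theta> i y) B (\<lambda>i. 0) \<theta>s \<psi>"
proof -
  have "A (u j) = (if j < d then 1 \<star> u (Suc j) else 0) + \<theta> j \<star> u j" if "j \<le> d" for j
    using that A_u[of j] A_u_top by (cases "j = d") (auto simp: add.commute)
  then show "represents smul d u A (\<lambda>i. 1) \<theta> (\<lambda>i. 0)"
    unfolding represents_def using u_independent by auto
  have "B (u j) = \<theta>s j \<star> u j + (if 0 < j then \<psi> j \<star> u (j - 1) else 0)" if "j \<le> d" for j
    using that B_u[of j] B_u_0 by (cases "j = 0") auto
  then show "represents smul d u B (\<lambda>i. 0) \<theta>s \<psi>"
    unfolding represents_def using u_independent by auto
qed

text \<open>The \<open>Q 0\<close>-component of \<open>B_u\<close>. In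
  \<open>split_scalar_dual\<close> this recursion, read in the dual pair, is set against
  \<open>P0_newton_functional\<close>.\<close>

lemma Q0_u: "(\<theta>s 0 - \<theta>s i) \<star> Q 0 (u i) = \<psi> i \<star> Q 0 (u (i - 1))" if i: "1 \<le> i" "i \<le> d"
proof -
  have "\<theta>s 0 \<star> Q 0 (u i) = \<theta>s i \<star> Q 0 (u i) + \<psi> i \<star> Q 0 (u (i - 1))"
    using arg_cong[OF B_u[OF i], of "Q 0"] by (simp add: B.P_A B.P_add B.P_smul)
  then show ?thesis by (simp add: A.scale_left_diff_distrib)
qed

lemma Q0_u_nz: "Q 0 (u i) \<noteq> 0" if "i \<le> d"
  using that
proof (induction i)
  case 0
  then show ?case using y by simp
next
  case (Suc i)
  then have "\<psi> (Suc i) \<star> Q 0 (u i) \<noteq> 0" using split_scalar_nz[of "Suc i"] by simp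
  then show ?case using Q0_u[of "Suc i"] Suc.prems by auto
qed

text \<open>The coefficients of \<open>x\<close> are peeled off from the top of its \<open>Q\<close>-support.\<close>

lemma u_span:
  assumes sub: "A.subspace S" and u: "\<And>i. i \<le> d \<Longrightarrow> u i \<in> S"
  shows "x \<in> S"
proof -
  have "x \<in> S" if "\<And>j. \<lbrakk>j \<le> d; k \<le> j\<rbrakk> \<Longrightarrow> Q j x = 0" "k \<le> Suc d" for k x
    using that
  proof (induction k arbitrary: x)
    case 0
    then have "x = 0" using B.eq_0I[of x] by simp
    then show ?case using sub by (simp add: A.subspace_0)
  next
    case (Suc k)
    then have k: "k \<le> d" by simp
    obtain c where c: "Q k x = c \<star> Q k (u k)"
      using B.rank_one[OF k Q_newton_y(2)[OF k]] by blast
    have "x - c \<star> u k \<in> S"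
    proof (rule Suc.IH)
      show "Q j (x - c \<star> u k) = 0" if "j \<le> d" "k \<le> j" for j
        using that c Suc.prems(1)[of j] Q_newton_y(1)[OF k, of j]
        by (cases "j = k") (auto simp: B.P_linear B.P_smul)
    qed (use k in simp)
    then have "(x - c \<star> u k) + c \<star> u k \<in> S"
      using sub u[OF k] by (intro A.subspace_add A.subspace_scale)
    then show ?case by simp
  qed
  from this[of "Suc d" x] show ?thesis by simp
qed

text \<open>The \<open>Q\<close>-support of \<open>u j\<close> lies in \<open>{0..j}\<close>, and
  for \<open>j < k\<close> each of these eigenvalues is a root of the product.\<close>

lemma newton_B_u_0: "newton smul B \<theta>s k (u j) = 0" if "j < k" "j \<le> d"
proof (rule B.eq_0I)
  fix l assume l: "l \<le> d"
  show "Q l (newton smul B \<theta>s k (u j)) = 0"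
  proof (cases "l < k")
    case True
    then have "(\<Prod>h<k. \<theta>s l - \<theta>s h) = 0" by (intro prod_zero) auto
    then show ?thesis using l by (simp add: B.P_newton)
  next
    case False
    then show ?thesis using l that Q_newton_y(1)[of j l] by (simp add: B.P_newton)
  qed
qed

lemma newton_Suc_B_u:
  assumes "1 \<le> i" "i \<le> d"
  shows "newton smul B c (Suc k) (u i) =
    (\<theta>s i - c k) \<star> newton smul B c k (u i) + \<psi> i \<star> newton smul B c k (u (i - 1))"
proof -
  have "newton smul B c (Suc k) (u i) = newton smul B c k ((\<theta>s i - c k) \<star> u i + \<psi> i \<star> u (i - 1))"
    unfolding B.newton_Suc_right B_u[OF assms] by (simp add: A.scale_left_diff_distrib algebra_simps)
  then show ?thesis by (simp add: B.newton_add B.newton_smul)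
qed

text \<open>Each factor in \<open>B\<close> reaches from \<open>u i\<close> no further down than
  \<open>u (i - 1)\<close>, so fewer than \<open>i\<close> factors never arrive at
  \<open>u 0\<close>, the only basis vector with a \<open>P 0\<close>-component.\<close>

lemma P0_newton_B_u_0: "P 0 (newton smul B c k (u i)) = 0" if "k < i" "i \<le> d"
  using that
proof (induction k arbitrary: i)
  case 0
  then show ?case by (simp add: P_u_0)
next
  case (Suc k)
  then show ?case by (subst newton_Suc_B_u) (auto simp: A.P_add A.P_smul)
qed

text \<open>On the basis \<open>u\<close> the maps \<open>P 0 \<circ> newton smul B \<theta>s i\<close> are, up to scalars, the coordinate functionals.\<close>

lemma P0_newton_functional:
  assumes i: "1 \<le> i" "i \<le> d"
  shows "P 0 (newton smul B \<theta>s i (A x - \<theta> i \<star> x)) = \<psi> i \<star> P 0 (newton smul B \<theta>s (i - 1) x)"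
proof -
  define F where "F k x = P 0 (newton smul B \<theta>s k x)" for k x
  have F: "F k (x + y) = F k x + F k y" "F k (c \<star> x) = c \<star> F k x" for k x y c
    by (auto simp: F_def B.newton_add B.newton_smul A.P_add A.P_smul)
  have F_u: "F k (u j) = 0" if "j \<le> d" "j \<noteq> k" for k j
    using that newton_B_u_0[of j k] P0_newton_B_u_0[of k j] by (cases "j < k") (auto simp: F_def A.P_linear)
  have "newton smul B \<theta>s i (u i) = (\<theta>s i - \<theta>s (i - 1)) \<star> newton smul B \<theta>s (i - 1) (u i)
      + \<psi> i \<star> newton smul B \<theta>s (i - 1) (u (i - 1))"
    using newton_Suc_B_u[OF i, of \<theta>s "i - 1"] i by simp
  \<comment> \<open>The functional \<open>F k\<close> vanishes on every \<open>u j\<close> except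
    \<open>u k\<close>; this recursion compares the remaining values for consecutive
    \<open>k\<close>.\<close>
  then have F_step: "F i (u i) = \<psi> i \<star> F (i - 1) (u (i - 1))"
    using F_u[of i "i - 1"] i by (simp add: F_def A.P_add A.P_smul)
  \<comment> \<open>Both sides of the claim are linear in \<open>x\<close>, so the solutions form a
    subspace and by \<open>u_span\<close> it suffices to test the vectors \<open>u j\<close>. The
    only nonzero case is \<open>j = i - 1\<close>, which is \<open>F_step\<close>; at
    \<open>j = i\<close> the coefficient \<open>\<theta> j - \<theta> i\<close> is zero.\<close>
  define S where "S = {x. F i (A x + (- \<theta> i) \<star> x) = \<psi> i \<star> F (i - 1) x}"
  have "x \<in> S"
  proof (rule u_span)
    define m where "m = - \<theta> i"
    define G where "G x = F i (A x) + m \<star> F i x" for x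
    have "F k 0 = 0" for k using F(2)[of k 0 0] by simp
    moreover have "G (x + y) = G x + G y" "G (c \<star> x) = c \<star> G x" for x y c
      by (simp_all add: G_def A.A_add A.A_smul F A.scale_right_distrib ac_simps)
    moreover have "x \<in> S \<longleftrightarrow> G x = \<psi> i \<star> F (i - 1) x" for x
      unfolding S_def G_def F m_def by simp
    ultimately show "A.subspace S"
      by (intro A.subspaceI)
        (simp_all add: F A.scale_right_distrib mult.commute, simp add: G_def A.A_linear)
    show "u j \<in> S" if j: "j \<le> d" for j
    proof -
      have "A (u j) + (- \<theta> i) \<star> u j = (if j < d then u (Suc j) else 0) + (\<theta> j - \<theta> i) \<star> u j"
        using j A_u[of j] A_u_top by (cases "j = d") (auto simp: A.scale_left_diff_distrib algebra_simps)
      moreover have "F i 0 = 0" using F(2)[of i 0 0] by simp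
      moreover have "F i (if j < d then u (Suc j) else 0) = \<psi> i \<star> F (i - 1) (u j)"
        using F_step F_u[of j "i - 1"] F_u[of "Suc j" i] i j \<open>F i 0 = 0\<close> by (cases "j = i - 1") auto
      ultimately show ?thesis using j i F_u[of j i] by (cases "j = i") (auto simp: S_def F)
    qed
  qed
  then show ?thesis by (simp add: S_def F_def)
qed

text \<open>By \<open>P_u\<close> the numerator is the factor between
  \<open>P (i - 1) (u (i - 1))\<close> and \<open>P (i - 1) y\<close>, the denominator the one
  between \<open>P i (u i)\<close> and \<open>P i y\<close>. Evaluating
  \<open>P (i - 1) (B (u i))\<close> through \<open>P i (u i)\<close> and through \<open>B_u\<close>
  relates them.\<close>

lemma P_B_y:
  assumes i: "1 \<le> i" "i \<le> d"
  shows "P (i - 1) (B (P i y)) =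
    (\<psi> i * ((\<Prod>h\<in>{0..<i - 1}. \<theta> (i - 1) - \<theta> h) / (\<Prod>h\<in>{0..<i}. \<theta> i - \<theta> h))) \<star> P (i - 1) y"
proof -
  let ?N = "\<Prod>h<i - 1. \<theta> (i - 1) - \<theta> h" and ?D = "\<Prod>h<i. \<theta> i - \<theta> h"
  have "P (i - 1) (B (u i)) = P (i - 1) (B (P i (u i)))"
    by (rule leonard_operators.Q_A_single[OF dual]) (use i P_u_0 in auto)
  also have "\<dots> = ?D \<star> P (i - 1) (B (P i y))"
    using i by (simp only: P_u B.A_smul A.P_smul)
  finally have "?D \<star> P (i - 1) (B (P i y)) = P (i - 1) (\<theta>s i \<star> u i + \<psi> i \<star> u (i - 1))"
    by (simp only: B_u[OF i])
  also have "\<dots> = (\<psi> i * ?N) \<star> P (i - 1) y"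
    using i P_u_0[of "i - 1" i] by (simp add: A.P_add A.P_smul P_u)
  finally have "(1 / ?D) \<star> ?D \<star> P (i - 1) (B (P i y)) = (1 / ?D) \<star> (\<psi> i * ?N) \<star> P (i - 1) y"
    by simp
  moreover have "?D \<noteq> 0" using i by (intro A.prod_diff_nz) auto
  ultimately show ?thesis by (simp add: atLeast0LessThan mult.commute)
qed

end

section \<open>Split sequences of the exchanged and reversed pairs\<close>

lemma ex_Q0: "\<exists>y. Q 0 y = y \<and> y \<noteq> 0"
  using B.P_nz[of 0] B.P_P[of 0 0] by auto

text \<open>Both sides describe how \<open>P 0 (newton smul B \<theta>s i z)\<close> with \<open>z\<close> in the range of \<open>P 0\<close> depends on \<open>i\<close>.\<close>

lemma split_scalar_dual:
  assumes i: "1 \<le> i" "i \<le> d"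
  shows "split_scalar smul d B Q \<theta>s A P \<theta> i = split_scalar smul d A P \<theta> B Q \<theta>s i"
proof -
  obtain y where y: "Q 0 y = y" "y \<noteq> 0" using ex_Q0 by blast
  interpret dual: leonard_operators smul d B Q \<theta>s A P \<theta> by (rule dual)
  obtain z where z: "P 0 z = z" "z \<noteq> 0" using dual.ex_Q0 by blast
  let ?v = "\<lambda>i. newton smul B \<theta>s i z"
  \<comment> \<open>As \<open>z\<close> is an eigenvector for \<open>\<theta> 0\<close>, the factor
    \<open>A - \<theta> i\<close> in \<open>P0_newton_functional\<close> becomes the scalar
    \<open>\<theta> 0 - \<theta> i\<close>.\<close>
  have "A z = \<theta> 0 \<star> z" using A.A_P[of 0 z] z by simp
  then have "(\<theta> 0 - \<theta> i) \<star> P 0 (?v i) = P 0 (newton smul B \<theta>s i (A z - \<theta> i \<star> z))"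
    by (simp flip: A.scale_left_diff_distrib add: B.newton_smul A.P_smul)
  also have "\<dots> = split_scalar smul d A P \<theta> B Q \<theta>s i \<star> P 0 (?v (i - 1))"
    by (rule P0_newton_functional[OF y i])
  finally show ?thesis
    \<comment> \<open>\<open>dual.Q0_u\<close> has the same left side with the other split scalar on
      the right, and the common vector is nonzero by \<open>dual.Q0_u_nz\<close>.\<close>
    using dual.Q0_u[OF z i] dual.Q0_u_nz[OF z, of "i - 1"] i by simp
qed

text \<open>The two split scalars compare the products of \<open>A - \<theta> (k - 1)\<close> and \<open>B - \<theta>s k\<close> in
  opposite orders.\<close>

lemma split_scalar_reverse_dual:
  assumes i: "1 \<le> i" "i \<le> d"
  shows "split_scalar smul d B (\<lambda>i. Q (d - i)) (\<lambda>i. \<theta>s (d - i)) A (\<lambda>i. P (d - i)) (\<lambda>i. \<theta> (d - i)) i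
    = split_scalar smul d A P \<theta> B Q \<theta>s (d - i + 1)"
proof -
  obtain y where y: "Q 0 y = y" "y \<noteq> 0" using ex_Q0 by blast
  define k where "k = d - i + 1"
  have k: "1 \<le> k" "k \<le> d" "d - i = k - 1" "d - (i - 1) = k" using i by (auto simp: k_def)
  let ?c = "split_scalar smul d A P \<theta> B Q \<theta>s k"
  have part: "split_part d (\<lambda>i. Q (d - i)) (\<lambda>i. P (d - i)) i = split_part d P Q (k - 1)" (is "?l = ?r")
  proof (intro equalityI subsetI)
    fix x assume x: "x \<in> ?l"
    have "Q (d - l) x = 0" if "l < i" for l using x that by (auto simp: split_part_def)
    then have "Q j x = 0" if "j \<le> d" "k - 1 < j" for j
    proof -
      have "d - j < i" using that i by (simp add: k_def)
      then have "Q (d - (d - j)) x = 0" by fact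
      then show ?thesis using that by simp
    qed
    moreover have "P (d - l) x = 0" if "l \<le> d" "i < l" for l
      using x that by (auto simp: split_part_def)
    from this[of "d - j" for j] have "P j x = 0" if "j < k - 1" for j
      using that i by (simp add: k_def)
    ultimately show "x \<in> ?r" by (simp add: split_part_def)
  next
    fix x assume "x \<in> ?r"
    then show "x \<in> ?l" using k i by (auto simp: split_part_def)
  qed
  show ?thesis
    unfolding k_def[symmetric] unfolding split_scalar_def[of _ _ B] part k(3,4)
  proof (rule the_equality)
    let ?L = "\<lambda>x. B (A x - \<theta> (k - 1) \<star> x) - \<theta>s k \<star> (A x - \<theta> (k - 1) \<star> x)"
    let ?u = "newton smul A \<theta> (k - 1) y"
    \<comment> \<open>The factor \<open>A - \<theta> (k - 1)\<close> raises \<open>u (k - 1)\<close>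
      to \<open>u k\<close>, and \<open>B - \<theta>s k\<close> then lowers it back, contributing
      \<open>?c\<close>.\<close>
    have "A ?u - \<theta> (k - 1) \<star> ?u = newton smul A \<theta> k y" using A_u[OF y, of "k - 1"] k by simp
    then have *: "?L ?u = ?c \<star> ?u" using B_u[OF y k(1,2)] by simp
    have "?L (b \<star> x) = b \<star> ?L x" for b x
      by (simp add: A.A_smul B.A_smul A.scale_right_diff_distrib B.A_linear mult.commute)
    then have "?L (b \<star> ?u) = ?c \<star> (b \<star> ?u)" for b
      by (simp only: *) (simp add: mult.commute)
    then show "\<forall>x\<in>split_part d P Q (k - 1). ?L x = ?c \<star> x"
      using split_part_eq[OF y, of _ "k - 1"] k by fastforce
    fix c assume "\<forall>x\<in>split_part d P Q (k - 1). ?L x = c \<star> x"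
    then have "c \<star> ?u = ?c \<star> ?u" using u_in_split_part[OF y, of "k - 1"] * k by simp
    then show "c = ?c" using newton_y_nz[OF y, of "k - 1" \<theta>] k by simp
  qed
qed

text \<open>The exchange in \<open>split_scalar_reverse_dual\<close> is undone by
  \<open>split_scalar_dual\<close> for the doubly reversed pair.\<close>

lemma split_scalar_reverse_both:
  assumes i: "1 \<le> i" "i \<le> d"
  shows "split_scalar smul d A (\<lambda>i. P (d - i)) (\<lambda>i. \<theta> (d - i)) B (\<lambda>i. Q (d - i)) (\<lambda>i. \<theta>s (d - i)) i
    = split_scalar smul d A P \<theta> B Q \<theta>s (d - i + 1)"
  using split_scalar_reverse_dual[OF i]
    leonard_operators.split_scalar_dual[OF leonard_operators.reverse_left[OF reverse_right] i] by simp

text \<open>Reversing only the \<open>Q i\<close> is the same as reversing both orderings of the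
  pair whose \<open>P i\<close> are already reversed.\<close>

lemma split_scalar_reverse_right:
  assumes i: "1 \<le> i" "i \<le> d"
  shows "split_scalar smul d A P \<theta> B (\<lambda>i. Q (d - i)) (\<lambda>i. \<theta>s (d - i)) i
    = split_scalar smul d A (\<lambda>i. P (d - i)) (\<lambda>i. \<theta> (d - i)) B Q \<theta>s (d - i + 1)"
proof -
  have "split_scalar smul d A P \<theta> B (\<lambda>i. Q (d - i)) (\<lambda>i. \<theta>s (d - i)) i =
    split_scalar smul d A (\<lambda>i. P (d - (d - i))) (\<lambda>i. \<theta> (d - (d - i))) B (\<lambda>i. Q (d - i)) (\<lambda>i. \<theta>s (d - i)) i"
    using i by (intro split_scalar_cong) auto
  also have "\<dots> = split_scalar smul d A (\<lambda>i. P (d - i)) (\<lambda>i. \<theta> (d - i)) B Q \<theta>s (d - i + 1)"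
    by (rule leonard_operators.split_scalar_reverse_both[OF reverse_left i])
  finally show ?thesis .
qed

end

section \<open>The eigenbases\<close>

lemma sum_tridiagonal:
  fixes f :: "nat \<Rightarrow> 'a::ab_group_add"
  assumes "j \<le> d" "\<And>i. \<lbrakk>i \<le> d; i + 1 < j \<or> j + 1 < i\<rbrakk> \<Longrightarrow> f i = 0"
  shows "(\<Sum>i\<le>d. f i) = (if j < d then f (Suc j) else 0) + f j + (if 0 < j then f (j - 1) else 0)"
proof -
  have "(\<Sum>i\<le>d. f i) = (\<Sum>i\<in>{i. i \<le> d \<and> i \<le> j + 1 \<and> j \<le> i + 1}. f i)"
    using assms(2) by (intro sum.mono_neutral_right) (auto, (meson not_le)+)
  also have "{i. i \<le> d \<and> i \<le> j + 1 \<and> j \<le> i + 1} =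
      (if j < d then {Suc j} else {}) \<union> ({j} \<union> (if 0 < j then {j - 1} else {}))"
    using assms(1) by auto
  also have "sum f \<dots> = (if j < d then f (Suc j) else 0) + (f j + (if 0 < j then f (j - 1) else 0))"
    by (subst sum.union_disjoint; (subst sum.union_disjoint)?) auto
  finally show ?thesis by (simp add: add.assoc)
qed

context leonard_operators
begin

text \<open>Above the diagonal the entries come from \<open>P_B_y\<close>, below it from
  \<open>P_B_y\<close> for the reversed \<open>P i\<close>, and on it from the assumption on
  \<open>a\<close>.\<close>

lemma eigenbasis_represents:
  assumes y: "Q 0 y = y" "y \<noteq> 0"
  assumes a: "\<And>i x. i \<le> d \<Longrightarrow> P i (B (P i x)) = a i \<star> P i x"
  assumes \<phi>: "\<And>i. \<lbrakk>1 \<le> i; i \<le> d\<rbrakk> \<Longrightarrow> split_scalar smul d A P \<theta> B Q \<theta>s i = \<phi> i"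
  assumes \<phi>': "\<And>i. \<lbrakk>1 \<le> i; i \<le> d\<rbrakk> \<Longrightarrow>
      split_scalar smul d A (\<lambda>i. P (d - i)) (\<lambda>i. \<theta> (d - i)) B Q \<theta>s (d - i + 1) = \<phi>' i"
  shows "represents smul d (\<lambda>i. P i y) A (\<lambda>i. 0) \<theta> (\<lambda>i. 0)"
    and "represents smul d (\<lambda>i. P i y) B
      (\<lambda>i. \<phi>' i * ((\<Prod>h\<in>{i + 1..d}. \<theta> i - \<theta> h) / (\<Prod>h\<in>{i..d}. \<theta> (i - 1) - \<theta> h))) a
      (\<lambda>i. \<phi> i * ((\<Prod>h\<in>{0..<i - 1}. \<theta> (i - 1) - \<theta> h) / (\<Prod>h\<in>{0..<i}. \<theta> i - \<theta> h)))"
proof -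
  define L where "L i = \<phi>' i * ((\<Prod>h\<in>{i + 1..d}. \<theta> i - \<theta> h) / (\<Prod>h\<in>{i..d}. \<theta> (i - 1) - \<theta> h))" for i
  define U where "U i = \<phi> i * ((\<Prod>h\<in>{0..<i - 1}. \<theta> (i - 1) - \<theta> h) / (\<Prod>h\<in>{0..<i}. \<theta> i - \<theta> h))" for i
  have indep: "c j = 0" if 0: "(\<Sum>i\<le>d. c i \<star> P i y) = 0" and j: "j \<le> d" for c j
  proof -
    have "P j (\<Sum>i\<le>d. c i \<star> P i y) = (\<Sum>i\<le>d. if j = i then c j \<star> P j y else 0)"
      unfolding A.P_linear using j by (intro sum.cong) (auto simp: A.P_smul A.P_P)
    then have "c j \<star> P j y = 0" using 0 j by (simp add: A.P_linear)
    then show ?thesis using P_y_nz[OF y j] by simp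
  qed
  show "represents smul d (\<lambda>i. P i y) A (\<lambda>i. 0) \<theta> (\<lambda>i. 0)"
    unfolding represents_def using indep by (auto simp: A.A_P)
  have upper: "P (i - 1) (B (P i y)) =
      U i \<star> P (i - 1) y"
    if "1 \<le> i" "i \<le> d" for i
    using P_B_y[OF y that] \<phi>[OF that] by (simp add: U_def)
  have lower: "P i (B (P (i - 1) y)) =
      L i \<star> P i y"
    if i: "1 \<le> i" "i \<le> d" for i
  proof -
    \<comment> \<open>Under reversal the indices \<open>i\<close> and \<open>i - 1\<close> become
      \<open>k - 1\<close> and \<open>k\<close>, so the subdiagonal entry is a superdiagonal entry
      of the reversed pair.\<close>
    define k where "k = d - i + 1"
    have k: "1 \<le> k" "k \<le> d" "d - (k - 1) = i" "d - k = i - 1" using i by (auto simp: k_def)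
    have "(\<Prod>h\<in>{0..<m}. \<theta> l - \<theta> (d - h)) = (\<Prod>h\<in>{d - m + 1..d}. \<theta> l - \<theta> h)"
      if "m \<le> d" for m l
      using that by (intro prod.reindex_bij_witness[of _ "\<lambda>h. d - h" "\<lambda>h. d - h"]) auto
    from this[of "k - 1" i] this[of k "i - 1"]
    have "(\<Prod>h\<in>{0..<k - 1}. \<theta> i - \<theta> (d - h)) = (\<Prod>h\<in>{i + 1..d}. \<theta> i - \<theta> h)"
      "(\<Prod>h\<in>{0..<k}. \<theta> (i - 1) - \<theta> (d - h)) = (\<Prod>h\<in>{i..d}. \<theta> (i - 1) - \<theta> h)"
      using i k by simp_all
    moreover note leonard_operators.P_B_y[OF reverse_left y k(1,2)]
    ultimately show ?thesis using \<phi>'[OF i] unfolding k L_def by (simp add: k_def)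
  qed
  have "B (P j y) = (if j < d then L (Suc j) \<star> P (Suc j) y else 0) + a j \<star> P j y +
      (if 0 < j then U j \<star> P (j - 1) y else 0)" if "j \<le> d" for j
  proof -
    have "B (P j y) = (\<Sum>i\<le>d. P i (B (P j y)))" by (simp only: A.P_sum)
    also have "\<dots> = (if j < d then P (Suc j) (B (P j y)) else 0) + P j (B (P j y)) +
        (if 0 < j then P (j - 1) (B (P j y)) else 0)"
      using that by (intro sum_tridiagonal P_B_P) auto
    also have "\<dots> = (if j < d then L (Suc j) \<star> P (Suc j) y else 0) + a j \<star> P j y +
        (if 0 < j then U j \<star> P (j - 1) y else 0)"
      using that a[OF that, of y] lower[of "Suc j"] upper[of j] by (cases "j = 0") auto
    finally show ?thesis .
  qed
  then show "represents smul d (\<lambda>i. P i y) B (\<lambda>i. \<phi>' i * ((\<Prod>h\<in>{i + 1..d}. \<theta> i - \<theta> h) / (\<Prod>h\<in>{i..d}. \<theta> (i - 1) - \<theta> h))) a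
      (\<lambda>i. \<phi> i * ((\<Prod>h\<in>{0..<i - 1}. \<theta> (i - 1) - \<theta> h) / (\<Prod>h\<in>{0..<i}. \<theta> i - \<theta> h)))"
    unfolding L_def[symmetric] U_def[symmetric]
    unfolding represents_def using indep by blast
qed

end

section \<open>Matrix entries, traces and minimal polynomials\<close>

text \<open>The coordinates of an isomorphism onto matrices, so that calculations with matrix units
  stay inside the algebra.\<close>

locale matrix_entries = vector_space scale
  for scale :: "'k::field \<Rightarrow> 'a::ring_1 \<Rightarrow> 'a" +
  fixes d :: nat and m :: "'a \<Rightarrow> nat \<Rightarrow> nat \<Rightarrow> 'k"
  assumes entry_add: "\<lbrakk>i \<le> d; j \<le> d\<rbrakk> \<Longrightarrow> m (X + Y) i j = m X i j + m Y i j"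
    and entry_scale: "\<lbrakk>i \<le> d; j \<le> d\<rbrakk> \<Longrightarrow> m (scale c X) i j = c * m X i j"
    and entry_mult: "\<lbrakk>i \<le> d; j \<le> d\<rbrakk> \<Longrightarrow> m (X * Y) i j = (\<Sum>k\<le>d. m X i k * m Y k j)"
    and entry_one: "\<lbrakk>i \<le> d; j \<le> d\<rbrakk> \<Longrightarrow> m 1 i j = (if i = j then 1 else 0)"
    and entry_eqI: "(\<And>i j. \<lbrakk>i \<le> d; j \<le> d\<rbrakk> \<Longrightarrow> m X i j = m Y i j) \<Longrightarrow> X = Y"
    and entry_surj: "\<exists>X. \<forall>i\<le>d. \<forall>j\<le>d. m X i j = M i j"
begin

lemma entry_zero: "\<lbrakk>i \<le> d; j \<le> d\<rbrakk> \<Longrightarrow> m 0 i j = 0"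
  using entry_scale[of i j 0 0] by simp

lemma entry_sum: "\<lbrakk>i \<le> d; j \<le> d\<rbrakk> \<Longrightarrow> m (sum F S) i j = (\<Sum>s\<in>S. m (F s) i j)"
  by (induction S rule: infinite_finite_induct) (auto simp: entry_zero entry_add)

definition munit :: "nat \<Rightarrow> nat \<Rightarrow> 'a" where
  "munit k l = (SOME X. \<forall>i\<le>d. \<forall>j\<le>d. m X i j = (if i = k \<and> j = l then 1 else 0))"

lemma entry_munit: "\<lbrakk>i \<le> d; j \<le> d\<rbrakk> \<Longrightarrow> m (munit k l) i j = (if i = k \<and> j = l then 1 else 0)"
  using someI_ex[OF entry_surj[of "\<lambda>i j. if i = k \<and> j = l then 1 else 0"]]
  by (simp add: munit_def)

lemma entry_mult_munit:
  assumes "i \<le> d" "l \<le> d" "j \<le> d"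
  shows "m (X * munit j k) i l = (if l = k then m X i j else 0)"
  using assms by (cases "l = k") (auto simp: entry_mult entry_munit if_distrib cong: if_cong)

lemma entry_munit_mult:
  assumes "i \<le> d" "l \<le> d" "j \<le> d"
  shows "m (munit k j * X) i l = (if i = k then m X j l else 0)"
proof -
  have "m (munit k j * X) i l = (\<Sum>a\<le>d. if j = a then (if i = k then m X a l else 0) else 0)"
    unfolding entry_mult[OF assms(1,2)] using assms by (intro sum.cong) (auto simp: entry_munit)
  then show ?thesis using assms by simp
qed

lemma mult_munit:
  assumes "j \<le> d"
  shows "X * munit j k = (\<Sum>i\<le>d. scale (m X i j) (munit i k))"
proof (rule entry_eqI)
  fix i l assume il: "i \<le> d" "l \<le> d"
  then have "m (\<Sum>i\<le>d. scale (m X i j) (munit i k)) i l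
      = (\<Sum>a\<le>d. if i = a then (if l = k then m X a j else 0) else 0)"
    unfolding entry_sum[OF il] by (intro sum.cong) (auto simp: entry_scale entry_munit)
  then show "m (X * munit j k) i l = m (\<Sum>i\<le>d. scale (m X i j) (munit i k)) i l"
    using il assms by (simp add: entry_mult_munit)
qed

lemma munit_mult_munit:
  assumes "i \<le> d" "j \<le> d"
  shows "munit k i * X * munit j k = scale (m X i j) (munit k k)"
  using assms
  by (intro entry_eqI) (simp add: entry_mult_munit entry_munit_mult entry_scale entry_munit)

lemma one_eq_sum_munit: "1 = (\<Sum>i\<le>d. munit i i)"
proof (rule entry_eqI)
  fix i j assume "i \<le> d" "j \<le> d"
  then have "m (\<Sum>i\<le>d. munit i i) i j = (\<Sum>l\<le>d. if i = l then (if i = j then 1 else 0) else 0)"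
    unfolding entry_sum[OF \<open>i \<le> d\<close> \<open>j \<le> d\<close>] by (intro sum.cong) (auto simp: entry_munit)
  then show "m 1 i j = m (\<Sum>i\<le>d. munit i i) i j"
    using \<open>i \<le> d\<close> \<open>j \<le> d\<close> by (simp add: entry_one)
qed

text \<open>This finite spanning set bounds the number of independent powers in
  \<open>ex_annihilating_poly\<close>.\<close>

lemma span_munit: "span ((\<lambda>(i, j). munit i j) ` ({..d} \<times> {..d})) = UNIV"
proof -
  have "X \<in> span ((\<lambda>(i, j). munit i j) ` ({..d} \<times> {..d}))" for X
  proof -
    have "X = (\<Sum>j\<le>d. X * munit j j)"
      by (simp flip: sum_distrib_left one_eq_sum_munit)
    also have "\<dots> = (\<Sum>j\<le>d. \<Sum>i\<le>d. scale (m X i j) (munit i j))"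
      by (simp add: mult_munit)
    also have "\<dots> \<in> span ((\<lambda>(i, j). munit i j) ` ({..d} \<times> {..d}))"
      by (intro span_sum span_scale span_base) auto
    finally show ?thesis .
  qed
  then show ?thesis by blast
qed

definition entry_trace :: "'a \<Rightarrow> 'k" where
  "entry_trace X = (\<Sum>i\<le>d. m X i i)"

lemma entry_trace_mult_commute: "entry_trace (X * Y) = entry_trace (Y * X)"
proof -
  have "entry_trace (X * Y) = (\<Sum>i\<le>d. \<Sum>k\<le>d. m X i k * m Y k i)"
    by (simp add: entry_trace_def entry_mult)
  also have "\<dots> = (\<Sum>k\<le>d. \<Sum>i\<le>d. m X i k * m Y k i)" by (rule sum.swap)
  finally show ?thesis by (simp add: entry_trace_def entry_mult mult.commute)
qed

lemma entry_trace_scale: "entry_trace (scale c X) = c * entry_trace X"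
  by (simp add: entry_trace_def entry_scale sum_distrib_left)

text \<open>Inserting matrix units for \<open>X\<close> shows that each product of a column and a
  row of \<open>E\<close> is a multiple of \<open>E\<close>. Comparing at a nonzero entry
  \<open>(a, b)\<close> gives \<open>m E i i * m E a b = m E a i * m E i b\<close>; summing over
  \<open>i\<close> and using \<open>E * E = E\<close> yields the trace in any
  characteristic.\<close>

lemma entry_trace_rank_one:
  assumes "E * E = E" "E \<noteq> 0" and rank: "\<And>X. \<exists>c. E * X * E = scale c E"
  shows "entry_trace E = 1"
proof -
  obtain a b where ab: "a \<le> d" "b \<le> d" "m E a b \<noteq> 0"
    using entry_eqI[of E 0] \<open>E \<noteq> 0\<close> entry_zero by auto
  have "\<exists>c. \<forall>i\<le>d. \<forall>j\<le>d. m E i k * m E l j = c * m E i j" if "k \<le> d" "l \<le> d" for k l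
  proof -
    obtain c where c: "E * munit k l * E = scale c E" using rank by blast
    have "m (E * munit k l * E) i j = m E i k * m E l j" if "i \<le> d" "j \<le> d" for i j
    proof -
      have "m (E * munit k l * E) i j = (\<Sum>a\<le>d. if a = l then m E i k * m E l j else 0)"
        unfolding entry_mult[of i j "E * munit k l" E, OF that]
        using that \<open>k \<le> d\<close> by (intro sum.cong) (auto simp: entry_mult_munit)
      then show ?thesis using \<open>l \<le> d\<close> by simp
    qed
    then show ?thesis using entry_scale[of _ _ c E] by (intro exI[of _ c]) (simp add: c)
  qed
  then obtain c where c: "\<And>i j k l. \<lbrakk>i \<le> d; j \<le> d; k \<le> d; l \<le> d\<rbrakk>
      \<Longrightarrow> m E i k * m E l j = c k l * m E i j"
    by metis
  have "m E i i * m E a b = m E a i * m E i b" if "i \<le> d" for i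
  proof -
    have "m E a i * m E a b = c i a * m E a b" using c[of a b i a] ab that by simp
    then have "c i a = m E a i" using ab by simp
    then show ?thesis using c[of i b i a] ab that by simp
  qed
  then have "entry_trace E * m E a b = (\<Sum>i\<le>d. m E a i * m E i b)"
    by (simp add: entry_trace_def sum_distrib_right)
  also have "\<dots> = m E a b" using entry_mult[of a b E E] ab assms(1) by simp
  finally show ?thesis using ab by simp
qed

end

section \<open>Traces and minimal polynomials in the abstract algebra\<close>

context matrix_algebra
begin

lemma entries_iso:
  assumes "mat_alg_iso scale (Suc d) f"
  shows "matrix_entries scale d (\<lambda>X i j. f X $$ (i, j))"
proof -
  have bij: "bij_betw f UNIV (carrier_mat (Suc d) (Suc d))"
    and hom: "\<And>X Y. f (X + Y) = f X + f Y" "\<And>X Y. f (X * Y) = f X * f Y"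
      "\<And>c X. f (scale c X) = c \<cdot>\<^sub>m f X" "f 1 = 1\<^sub>m (Suc d)"
    using assms by (auto simp: mat_alg_iso_def)
  have carrier: "f X \<in> carrier_mat (Suc d) (Suc d)" for X using bij by (auto simp: bij_betw_def)
  have dim: "dim_row (f X) = Suc d" "dim_col (f X) = Suc d" for X using carrier[of X] by auto
  show ?thesis
  proof unfold_locales
    show "f (X * Y) $$ (i, j) = (\<Sum>k\<le>d. f X $$ (i, k) * f Y $$ (k, j))"
      if "i \<le> d" "j \<le> d" for X Y i j
      using that by (simp add: hom dim scalar_prod_def atLeast0LessThan lessThan_Suc_atMost)
    show "X = Y" if "\<And>i j. \<lbrakk>i \<le> d; j \<le> d\<rbrakk> \<Longrightarrow> f X $$ (i, j) = f Y $$ (i, j)" for X Y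
    proof -
      have "f X = f Y" using that by (intro eq_matI) (auto simp: dim)
      then show ?thesis using bij by (auto simp: bij_betw_def inj_def)
    qed
    show "\<exists>X. \<forall>i\<le>d. \<forall>j\<le>d. f X $$ (i, j) = M i j" for M
    proof -
      have "mat (Suc d) (Suc d) (\<lambda>(i, j). M i j) \<in> range f" using bij by (auto simp: bij_betw_def)
      then obtain X where "f X = mat (Suc d) (Suc d) (\<lambda>(i, j). M i j)" by auto
      then show ?thesis by (intro exI[of _ X]) auto
    qed
  qed (auto simp: hom dim)
qed

text \<open>If \<open>E * X * E = scale c E\<close>, then \<open>X * E = X * E * E\<close> has the
  same trace as \<open>E * X * E\<close>, namely \<open>c\<close> times the trace of
  \<open>E\<close>, which is one. This holds under every isomorphism, so the description in
  \<open>alg_trace\<close> is well defined.\<close>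

lemma alg_trace_rank_one:
  assumes "E * E = E" "E \<noteq> 0" and rank: "\<And>X. \<exists>c. E * X * E = scale c E"
  shows "E * X * E = scale (alg_trace scale d (X * E)) E"
proof -
  obtain c where c: "E * X * E = scale c E" using rank by blast
  have tr: "sum_list (diag_mat (f (X * E))) = c" if f: "mat_alg_iso scale (Suc d) f" for f
  proof -
    interpret matrix_entries scale d "\<lambda>X i j. f X $$ (i, j)" by (rule entries_iso[OF f])
    have "f (X * E) \<in> carrier_mat (Suc d) (Suc d)"
      using f unfolding mat_alg_iso_def bij_betw_def by blast
    then have "sum_list (diag_mat (f (X * E))) = entry_trace (X * E)"
      by (simp add: diag_mat_def entry_trace_def interv_sum_list_conv_sum_set_nat
          atLeast0LessThan lessThan_Suc_atMost del: upt_Suc)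
    also have "\<dots> = entry_trace (X * E * E)" by (simp add: mult.assoc assms(1))
    also have "\<dots> = entry_trace (E * X * E)"
      by (subst entry_trace_mult_commute) (simp add: mult.assoc)
    also have "\<dots> = c" by (simp add: c entry_trace_scale entry_trace_rank_one[OF assms])
    finally show ?thesis .
  qed
  have "alg_trace scale d (X * E) = c"
    unfolding alg_trace_def by (rule the_equality) (use tr iso in auto)
  then show ?thesis using c by simp
qed

lemma alg_poly_eq:
  assumes "degree p \<le> n"
  shows "alg_poly scale p X = (\<Sum>i\<le>n. scale (coeff p i) (X ^ i))"
  unfolding alg_poly_def using assms
  by (intro sum.mono_neutral_left) (auto simp: coeff_eq_0)

lemma alg_poly_diff: "alg_poly scale (p - q) X = alg_poly scale p X - alg_poly scale q X"
proof -
  define n where "n = max (degree p) (degree q)"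
  have "degree (p - q) \<le> n" unfolding n_def by (rule degree_diff_le_max)
  then show ?thesis
    by (simp add: alg_poly_eq[of _ n] n_def scale_left_diff_distrib sum_subtractf)
qed

lemma alg_poly_smult: "alg_poly scale (smult c p) X = scale c (alg_poly scale p X)"
  using degree_smult_le[of c p]
  by (simp add: alg_poly_eq[of "smult c p" "degree p"] alg_poly_eq[of p "degree p"] scale_sum_right)

lemma alg_poly_pCons_0: "alg_poly scale (pCons 0 p) X = X * alg_poly scale p X"
proof -
  have "alg_poly scale (pCons 0 p) X = (\<Sum>i\<le>Suc (degree p). scale (coeff (pCons 0 p) i) (X ^ i))"
    by (rule alg_poly_eq) (rule degree_pCons_le)
  also have "\<dots> = (\<Sum>i\<le>degree p. X * scale (coeff p i) (X ^ i))"
    by (simp add: sum.atMost_Suc_shift scale_mult_right del: sum.atMost_Suc)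
  finally show ?thesis by (simp add: alg_poly_def sum_distrib_left)
qed

lemma alg_poly_linear_factor:
  "alg_poly scale ([:- c, 1:] * q) X = (X - scale c 1) * alg_poly scale q X"
proof -
  have "[:- c, 1:] * q = pCons 0 q - smult c q" by simp
  then have "alg_poly scale ([:- c, 1:] * q) X = X * alg_poly scale q X - scale c (alg_poly scale q X)"
    by (simp only: alg_poly_diff alg_poly_smult alg_poly_pCons_0)
  then show ?thesis using scale_mult_left[of c 1 "alg_poly scale q X"] by (simp add: left_diff_distrib)
qed

text \<open>The \<open>n + 1\<close> powers \<open>X ^ 0\<close>, ..., \<open>X ^ n\<close> cannot
  be independent in a space spanned by \<open>n\<close> elements.\<close>

lemma ex_annihilating_poly: "\<exists>p. p \<noteq> 0 \<and> alg_poly scale p X = 0"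
proof -
  obtain f where f: "mat_alg_iso scale (Suc d) f" using iso by blast
  interpret matrix_entries scale d "\<lambda>X i j. f X $$ (i, j)" by (rule entries_iso[OF f])
  define S where "S = (\<lambda>(i, j). munit i j) ` ({..d} \<times> {..d})"
  define n where "n = card S"
  have fin: "finite S" by (simp add: S_def)
  obtain u where u: "(\<Sum>i\<le>n. scale (u i) (X ^ i)) = 0" "\<exists>i\<le>n. u i \<noteq> 0"
  proof (cases "inj_on (\<lambda>i. X ^ i) {..n}")
    case True
    have "dependent ((\<lambda>i. X ^ i) ` {..n})"
    proof (rule ccontr)
      assume "independent ((\<lambda>i. X ^ i) ` {..n})"
      then have "card ((\<lambda>i. X ^ i) ` {..n}) \<le> card S"
        by (intro independent_span_bound[THEN conjunct2] fin) (auto simp: span_munit S_def)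
      then show False using card_image[OF True] by (simp add: n_def)
    qed
    then obtain w where "\<exists>v\<in>(\<lambda>i. X ^ i) ` {..n}. w v \<noteq> 0"
      "(\<Sum>v\<in>(\<lambda>i. X ^ i) ` {..n}. scale (w v) v) = 0"
      by (auto simp: dependent_finite)
    then show ?thesis using that[of "\<lambda>i. w (X ^ i)"] by (auto simp: sum.reindex[OF True])
  next
    \<comment> \<open>Dependence of a set does not see repeated powers; here
      \<open>X ^ i = X ^ j\<close> is itself the relation.\<close>
    case False
    then obtain i j where ij: "i \<le> n" "j \<le> n" "i \<noteq> j" "X ^ i = X ^ j" by (auto simp: inj_on_def)
    define u :: "nat \<Rightarrow> 'k" where "u l = (if l = i then 1 else 0) - (if l = j then 1 else 0)" for l
    have "(\<Sum>l\<le>n. scale (u l) (X ^ l)) = X ^ i - X ^ j"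
      using ij by (simp add: u_def scale_left_diff_distrib sum_subtractf if_distrib[of "\<lambda>c. scale c _"]
        cong: if_cong)
    then show ?thesis by (intro that[of u] exI[of _ i]) (use ij in \<open>auto simp: u_def\<close>)
  qed
  define p where "p = (\<Sum>i\<le>n. monom (u i) i)"
  have coeff: "coeff p i = (if i \<le> n then u i else 0)" for i
    by (simp add: p_def coeff_sum)
  have "degree p \<le> n" by (rule degree_le) (simp add: coeff)
  then have "alg_poly scale p X = 0" using u(1) by (simp add: alg_poly_eq coeff)
  moreover have "p \<noteq> 0" using u(2) coeff by (metis coeff_0)
  ultimately show ?thesis by blast
qed

text \<open>An annihilating polynomial of least degree can be made monic, and two such have a
  difference of smaller degree that annihilates \<open>X\<close>, hence is zero. So
  \<open>min_poly\<close> denotes this polynomial.\<close>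

lemma min_poly:
  shows "min_poly scale X \<noteq> 0" "alg_poly scale (min_poly scale X) X = 0"
    and "\<lbrakk>q \<noteq> 0; alg_poly scale q X = 0\<rbrakk> \<Longrightarrow> degree (min_poly scale X) \<le> degree q"
proof -
  let ?M = "\<lambda>p. lead_coeff p = 1 \<and> alg_poly scale p X = 0 \<and>
     (\<forall>q. q \<noteq> 0 \<and> alg_poly scale q X = 0 \<longrightarrow> degree p \<le> degree q)"
  obtain p where p: "p \<noteq> 0" "alg_poly scale p X = 0"
    "\<And>q. q \<noteq> 0 \<Longrightarrow> alg_poly scale q X = 0 \<Longrightarrow> degree p \<le> degree q"
    using ex_annihilating_poly
      ex_has_least_nat[of "\<lambda>p. p \<noteq> 0 \<and> alg_poly scale p X = 0" _ degree] by blast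
  have ex: "?M (smult (inverse (lead_coeff p)) p)"
    using p by (auto simp: alg_poly_smult)
  have uniq: "p' = q'" if p': "?M p'" and q': "?M q'" for p' q'
  proof (rule ccontr)
    assume "p' \<noteq> q'"
    then have nz: "p' - q' \<noteq> 0" by simp
    have "p' \<noteq> 0" "q' \<noteq> 0" using p' q' by auto
    then have deg: "degree p' = degree q'" using p' q' by (meson antisym)
    then have "degree p' \<le> degree (p' - q')" using p' q' nz by (auto simp: alg_poly_diff)
    moreover have "degree (p' - q') \<le> degree p'" using degree_diff_le_max[of p' q'] deg by simp
    ultimately have "degree (p' - q') = degree p'" by simp
    then have "lead_coeff (p' - q') = 0" using p' q' deg by (metis coeff_diff diff_self)
    with nz show False unfolding leading_coeff_0_iff by blast
  qed
  have "?M (min_poly scale X)" unfolding min_poly_def by (rule theI[of ?M, OF ex]) (rule uniq[OF _ ex])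
  then show "min_poly scale X \<noteq> 0" "alg_poly scale (min_poly scale X) X = 0"
    "\<lbrakk>q \<noteq> 0; alg_poly scale q X = 0\<rbrakk> \<Longrightarrow> degree (min_poly scale X) \<le> degree q"
    by auto
qed

end

section \<open>The irreducible module\<close>

locale algebra_module = matrix_algebra scale d + irreducible_module act
  for scale :: "'k::field \<Rightarrow> 'a::ring_1 \<Rightarrow> 'a" and d and act :: "'a \<Rightarrow> 'v::ab_group_add \<Rightarrow> 'v"
begin

abbreviation smul (infixr "\<star>" 75) where "smul \<equiv> vscale scale act"

lemma act_zero: "act 0 v = 0" "act X 0 = 0"
  using act_add_left[of 0 0 v] act_add_right[of X 0 0] by simp_all

lemma act_diff: "act (X - Y) v = act X v - act Y v" "act X (u - v) = act X u - act X v"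
  using act_add_left[of "X - Y" Y v] act_add_right[of X "u - v" v] by (simp_all add: algebra_simps)

lemma act_sum: "act (sum F S) v = (\<Sum>s\<in>S. act (F s) v)" "act X (sum w S) = (\<Sum>s\<in>S. act X (w s))"
  by (induction S rule: infinite_finite_induct) (auto simp: act_zero act_add_left act_add_right)

lemma act_scale: "act (scale c X) v = c \<star> act X v" "act X (c \<star> v) = c \<star> act X v"
  using scale_mult_left[of c 1 X] scale_mult_right[of c X 1]
  by (simp_all add: vscale_def flip: act_mult)

lemma vector_space_smul: "vector_space smul"
proof
  show "a \<star> b \<star> v = (a * b) \<star> v" for a b v
    using scale_mult_left[of a 1 "scale b 1"] by (simp add: vscale_def flip: act_mult)
qed (auto simp: vscale_def act_add_left act_add_right act_one scale_left_distrib)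

sublocale V: vector_space smul by (rule vector_space_smul)

lemma act_shift: "act (X - scale c 1) v = act X v - c \<star> v"
  by (simp add: act_diff act_scale act_one)

text \<open>For \<open>k\<close> with \<open>act (munit k k) v\<close> nonzero, the vectors
  \<open>act (munit i k) v\<close> span a submodule, which is everything by irreducibility. Since
  \<open>munit k i * X * munit j k\<close> is the \<open>(i, j)\<close> entry of \<open>X\<close>
  times \<open>munit k k\<close>, the action on \<open>v\<close> recovers all entries, whence
  faithfulness.\<close>

lemma ex_spanning: "\<exists>b. V.span (b ` {..d}) = UNIV"
  and act_faithful: "(\<And>v. act X v = act Y v) \<Longrightarrow> X = Y"
proof -
  obtain f where f: "mat_alg_iso scale (Suc d) f" using iso by blast
  interpret matrix_entries scale d "\<lambda>X i j. f X $$ (i, j)" by (rule entries_iso[OF f])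
  obtain v :: 'v where "v \<noteq> 0" using nontrivial by blast
  have v: "(\<Sum>i\<le>d. act (munit i i) v) = v"
    using act_one[of v] unfolding one_eq_sum_munit act_sum .
  obtain k where k: "k \<le> d" "act (munit k k) v \<noteq> 0"
  proof (rule ccontr)
    assume "\<not> thesis"
    then have "(\<Sum>i\<le>d. act (munit i i) v) = 0" using that by (intro sum.neutral) blast
    with v \<open>v \<noteq> 0\<close> show False by simp
  qed
  define b where "b i = act (munit i k) v" for i
  have act_b: "act X (b j) = (\<Sum>i\<le>d. f X $$ (i, j) \<star> b i)" if "j \<le> d" for X j
    using that by (simp add: b_def mult_munit act_sum act_scale flip: act_mult)
  let ?W = "V.span (b ` {..d})"
  have "act X w \<in> ?W" if "w \<in> ?W" for X w
    using that
  proof (induction rule: V.span_induct_alt)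
    case base
    then show ?case by (simp add: act_zero V.span_zero)
  next
    case (step c x y)
    then obtain j where "j \<le> d" "x = b j" by auto
    then have "act X x \<in> ?W"
      unfolding \<open>x = b j\<close> act_b[OF \<open>j \<le> d\<close>]
      by (intro V.span_sum V.span_scale V.span_base) auto
    then show ?case
      unfolding act_add_right act_scale using step by (intro V.span_add V.span_scale)
  qed
  then have "?W = {0} \<or> ?W = UNIV"
    by (intro irreducible V.span_zero V.span_add)
  moreover have "b k \<in> ?W" "b k \<noteq> 0" using k by (auto simp: b_def intro: V.span_base)
  ultimately have "?W = UNIV" by auto
  then show "\<exists>b. V.span (b ` {..d}) = UNIV" by blast
  assume eq: "\<And>v. act X v = act Y v"
  show "X = Y"
  proof (rule entry_eqI)
    fix i j assume ij: "i \<le> d" "j \<le> d"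
    have "act (munit k i * X * munit j k) v = act (munit k i * Y * munit j k) v"
      by (simp add: act_mult eq)
    then have "f X $$ (i, j) \<star> act (munit k k) v = f Y $$ (i, j) \<star> act (munit k k) v"
      using ij by (simp add: munit_mult_munit act_scale)
    then show "f X $$ (i, j) = f Y $$ (i, j)" using k by simp
  qed
qed

text \<open>By \<open>ex_spanning\<close> the space is spanned by at most \<open>d + 1\<close>
  vectors, so \<open>d + 1\<close> independent ones leave no room for another.\<close>

lemma independent_expansion:
  assumes indep: "\<And>c i. \<lbrakk>(\<Sum>i\<le>d. c i \<star> x i) = 0; i \<le> d\<rbrakk> \<Longrightarrow> c i = 0"
  shows "\<exists>c. v = (\<Sum>i\<le>d. c i \<star> x i)"
proof -
  obtain b where b: "V.span (b ` {..d}) = UNIV" using ex_spanning by blast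
  have inj: "inj_on x {..d}"
  proof (rule inj_onI, rule ccontr)
    fix i j assume ij: "i \<in> {..d}" "j \<in> {..d}" "x i = x j" "i \<noteq> j"
    have "(\<Sum>l\<le>d. ((if l = i then 1 else 0) - (if l = j then 1 else 0)) \<star> x l) = x i - x j"
      using ij by (simp add: V.scale_left_diff_distrib sum_subtractf if_distrib[of "\<lambda>c. c \<star> _"]
        cong: if_cong)
    then show False using indep[of "\<lambda>l. (if l = i then 1 else 0) - (if l = j then 1 else 0)" i] ij by auto
  qed
  have ind: "V.independent (x ` {..d})"
  proof (rule V.independent_if_scalars_zero)
    fix f y assume 0: "(\<Sum>y\<in>x ` {..d}. f y \<star> y) = 0" and y: "y \<in> x ` {..d}"
    then show "f y = 0" using indep[of "\<lambda>i. f (x i)"] by (auto simp: sum.reindex[OF inj])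
  qed simp
  have "v \<in> V.span (x ` {..d})"
  proof (rule ccontr)
    assume v: "v \<notin> V.span (x ` {..d})"
    then have "V.independent (insert v (x ` {..d}))" using ind by (simp add: V.independent_insert)
    then have "card (insert v (x ` {..d})) \<le> card (b ` {..d})"
      by (intro V.independent_span_bound[THEN conjunct2]) (auto simp: b)
    moreover have "v \<notin> x ` {..d}" using v V.span_superset[of "x ` {..d}"] by (metis subsetD)
    ultimately show False using card_image[OF inj] card_image_le[of "{..d}" b] by simp
  qed
  then obtain u where "v = (\<Sum>y\<in>x ` {..d}. u y \<star> y)" by (auto simp: V.span_finite)
  then show ?thesis by (auto simp: sum.reindex[OF inj])
qed

lemma act_power: "act X w = c \<star> w \<Longrightarrow> act (X ^ n) w = c ^ n \<star> w"
  by (induction n) (auto simp: act_one act_mult act_scale mult.commute)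

lemma act_alg_poly:
  assumes "act X w = c \<star> w"
  shows "act (alg_poly scale p X) w = poly p c \<star> w"
  by (simp add: alg_poly_def act_sum act_scale act_power[OF assms] poly_altdef V.scale_sum_left)

text \<open>Split off the linear factor of \<open>c\<close>; the cofactor \<open>q\<close> does not
  annihilate \<open>X\<close> by minimality, and by faithfulness some vector survives it. Its image
  is the eigenvector.\<close>

lemma ex_eigenvector:
  assumes "c \<in> eigenvals scale X"
  shows "\<exists>w. w \<noteq> 0 \<and> act X w = c \<star> w"
proof -
  have "[:- c, 1:] dvd min_poly scale X"
    using assms by (simp add: eigenvals_def poly_eq_0_iff_dvd)
  then obtain q where q: "min_poly scale X = [:- c, 1:] * q" by (elim dvdE)
  then have "q \<noteq> 0" using min_poly(1)[of X] by auto
  then have "degree (min_poly scale X) = Suc (degree q)"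
    unfolding q by (subst degree_mult_eq) auto
  then have "alg_poly scale q X \<noteq> 0" using min_poly(3)[OF \<open>q \<noteq> 0\<close>, of X] by auto
  then obtain v where v: "act (alg_poly scale q X) v \<noteq> 0"
    using act_faithful[of "alg_poly scale q X" 0] act_zero by metis
  have "act ((X - scale c 1) * alg_poly scale q X) v = 0"
    using min_poly(2)[of X] by (simp add: q flip: alg_poly_linear_factor) (simp add: act_zero)
  then show ?thesis using v by (intro exI[of _ "act (alg_poly scale q X) v"]) (simp add: act_mult act_shift)
qed

text \<open>The primitive idempotents act as the coordinate projections of an eigenbasis.\<close>

lemma spectral_operator_act:
  assumes mf: "multiplicity_free scale d X"
    and bij: "bij_betw E {..d} (prim_idempotent scale X ` eigenvals scale X)"
  shows "spectral_operator smul d (act X) (\<lambda>i. act (E i)) (eigenvalue_seq scale X E)"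
proof -
  let ?S = "eigenvals scale X" and ?\<theta> = "eigenvalue_seq scale X E"
  have fin: "finite ?S"
    using mf by (auto simp: multiplicity_free_def intro: card_ge_0_finite)
  obtain w where w: "\<And>c. c \<in> ?S \<Longrightarrow> w c \<noteq> 0" "\<And>c. c \<in> ?S \<Longrightarrow> act X (w c) = c \<star> w c"
  proof -
    have "\<forall>c\<in>?S. \<exists>w. w \<noteq> 0 \<and> act X w = c \<star> w" using ex_eigenvector by blast
    then show ?thesis using that by (auto dest!: bchoice)
  qed
  have prim: "act (prim_idempotent scale X \<xi>) (w c) = (if c = \<xi> then w c else 0)"
    if "\<xi> \<in> ?S" "c \<in> ?S" for \<xi> c
  proof -
    \<comment> \<open>The primitive idempotent is a Lagrange interpolation polynomial evaluated at
      \<open>X\<close>, so on an eigenvector it acts by one or zero.\<close>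
    have "poly (\<Prod>\<eta>\<in>?S - {\<xi>}. smult (1 / (\<xi> - \<eta>)) [:- \<eta>, 1:]) c = (\<Prod>\<eta>\<in>?S - {\<xi>}. (c - \<eta>) / (\<xi> - \<eta>))"
      by (simp add: poly_prod diff_divide_distrib)
    also have "\<dots> = (if c = \<xi> then 1 else 0)"
      using that fin by (auto intro!: prod.neutral prod_zero)
    finally show ?thesis using act_alg_poly[OF w(2)[OF that(2)]]
      by (simp add: prim_idempotent_def)
  qed
  \<comment> \<open>Distinct eigenvalues have distinct idempotents, which makes the description in
    \<open>eigenvalue_seq\<close> unique.\<close>
  have prim_inj: "\<xi> = \<xi>'" if "\<xi> \<in> ?S" "\<xi>' \<in> ?S" "prim_idempotent scale X \<xi> = prim_idempotent scale X \<xi>'" for \<xi> \<xi>'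
    using prim[of \<xi> \<xi>] prim[of \<xi>' \<xi>] w(1) that by (auto split: if_splits)
  have \<theta>: "?\<theta> i \<in> ?S \<and> E i = prim_idempotent scale X (?\<theta> i)" if "i \<le> d" for i
  proof -
    have "E i \<in> prim_idempotent scale X ` ?S" using bij that by (auto simp: bij_betw_def)
    then obtain c where c: "c \<in> ?S" "E i = prim_idempotent scale X c" by blast
    show ?thesis unfolding eigenvalue_seq_def
      by (rule theI[where a = c]) (use c prim_inj in auto)
  qed
  have \<theta>_inj: "inj_on ?\<theta> {..d}"
    using bij \<theta> unfolding bij_betw_def inj_on_def by (metis atMost_iff)
  define x where "x i = w (?\<theta> i)" for i
  have x: "x i \<noteq> 0" "act X (x i) = ?\<theta> i \<star> x i" if "i \<le> d" for i
    using \<theta>[OF that] w by (auto simp: x_def)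
  have E_x: "act (E i) (x j) = (if i = j then x i else 0)" if "i \<le> d" "j \<le> d" for i j
    using \<theta>[OF that(1)] \<theta>[OF that(2)] that prim[of "?\<theta> i" "?\<theta> j"] \<theta>_inj
    by (auto simp: x_def inj_on_def)
  have E_sum: "act (E i) (\<Sum>j\<le>d. c j \<star> x j) = c i \<star> x i" if "i \<le> d" for i c
  proof -
    have "act (E i) (\<Sum>j\<le>d. c j \<star> x j) = (\<Sum>j\<le>d. if i = j then c i \<star> x i else 0)"
      unfolding act_sum by (intro sum.cong) (auto simp: act_scale E_x that)
    then show ?thesis using that by simp
  qed
  have indep: "c i = 0" if "(\<Sum>i\<le>d. c i \<star> x i) = 0" "i \<le> d" for c i
    using E_sum[OF that(2), of c] that x(1) by (simp add: act_zero)
  have expansion: "\<exists>c. v = (\<Sum>i\<le>d. c i \<star> x i)" for v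
    using indep by (rule independent_expansion)
  have E_v: "\<exists>c. act (E i) v = c \<star> x i" if "i \<le> d" for i v
    using expansion[of v] E_sum[OF that] by metis
  show ?thesis
  proof unfold_locales
    show "act (E i) (act (E j) v) = (if i = j then act (E i) v else 0)" if "i \<le> d" "j \<le> d" for i j v
      using E_v[of j v] that by (auto simp: act_scale E_x act_zero)
    show "(\<Sum>i\<le>d. act (E i) v) = v" for v
      using expansion[of v] by (auto simp: E_sum)
    show "act X (act (E i) v) = ?\<theta> i \<star> act (E i) v" if "i \<le> d" for i v
      using E_v[of i v] that by (auto simp: act_scale x mult.commute)
    show "\<exists>v. act (E i) v \<noteq> 0" if "i \<le> d" for i
      using that by (intro exI[of _ "x i"]) (simp add: E_x x)
    show "\<exists>c. act (E i) v = c \<star> act (E i) u" if i: "i \<le> d" and u: "act (E i) u \<noteq> 0" for i u v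
    proof -
      obtain b c where bc: "act (E i) u = b \<star> x i" "act (E i) v = c \<star> x i"
        using E_v[OF i, of u] E_v[OF i, of v] by blast
      then have "b \<noteq> 0" using u by auto
      then show ?thesis using bc by (intro exI[of _ "c / b"]) simp
    qed
  qed (use \<theta>_inj in \<open>auto simp: act_add_right act_scale\<close>)
qed

section \<open>From the operators back to the notions of the theorem\<close>

lemma rep_matrix_eq:
  assumes rep: "represents smul d v (act X) l a u"
  shows "rep_matrix scale act d X v = tridiag d l a u"
  unfolding rep_matrix_def
proof (rule the_equality)
  let ?T = "tridiag d l a u"
  have indep: "c i = 0" if "(\<Sum>i\<le>d. c i \<star> v i) = 0" "i \<le> d" for c i
    using rep that by (auto simp: represents_def)
  have T: "act X (v j) = (\<Sum>i\<le>d. ?T $$ (i, j) \<star> v i)" if "j \<le> d" for j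
  proof -
    have "(\<Sum>i\<le>d. ?T $$ (i, j) \<star> v i) =
        (if j < d then ?T $$ (Suc j, j) \<star> v (Suc j) else 0) + ?T $$ (j, j) \<star> v j
        + (if 0 < j then ?T $$ (j - 1, j) \<star> v (j - 1) else 0)"
      using that by (intro sum_tridiagonal) (auto simp: tridiag_def)
    also have "\<dots> = act X (v j)"
      using rep that by (auto simp: represents_def tridiag_def)
    finally show ?thesis ..
  qed
  show "?T \<in> carrier_mat (Suc d) (Suc d) \<and> (\<forall>j\<le>d. act X (v j) = (\<Sum>i\<le>d. ?T $$ (i, j) \<star> v i))"
    using T by (auto simp: tridiag_def)
  fix M assume M: "M \<in> carrier_mat (Suc d) (Suc d) \<and>
    (\<forall>j\<le>d. act X (v j) = (\<Sum>i\<le>d. M $$ (i, j) \<star> v i))"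
  show "M = ?T"
  proof (rule eq_matI)
    fix i j assume "i < dim_row ?T" "j < dim_col ?T"
    then have ij: "i \<le> d" "j \<le> d" by (auto simp: tridiag_def)
    then have "(\<Sum>i\<le>d. M $$ (i, j) \<star> v i) = (\<Sum>i\<le>d. ?T $$ (i, j) \<star> v i)"
      using M T[of j] by simp
    then have "(\<Sum>i\<le>d. (M $$ (i, j) - ?T $$ (i, j)) \<star> v i) = 0"
      by (simp add: V.scale_left_diff_distrib sum_subtractf)
    from indep[OF this ij(1)] show "M $$ (i, j) = ?T $$ (i, j)" by simp
  qed (use M in \<open>auto simp: tridiag_def\<close>)
qed

text \<open>A new factor is appended on the right in \<open>tau_op\<close> but on the left in
  \<open>newton\<close>; the two agree because \<open>tau_op\<close> commutes with
  \<open>X\<close>.\<close>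

lemma act_tau_op: "act (tau_op scale X \<theta> i) v = newton smul (act X) \<theta> i v"
proof (induction i)
  case 0
  then show ?case by (simp add: tau_op_def act_one)
next
  case (Suc i)
  have Suc_eq: "tau_op scale X \<theta> (Suc i) = tau_op scale X \<theta> i * (X - scale (\<theta> i) 1)" for i
    by (simp add: tau_op_def)
  have shift: "(X - scale (\<theta> i) 1) * X = X * (X - scale (\<theta> i) 1)" for i
    using scale_mult_left[of "\<theta> i" 1 X] scale_mult_right[of "\<theta> i" X 1] by (simp add: algebra_simps)
  have comm: "tau_op scale X \<theta> i * X = X * tau_op scale X \<theta> i" for i
  proof (induction i)
    case (Suc i)
    have "tau_op scale X \<theta> (Suc i) * X = tau_op scale X \<theta> i * X * (X - scale (\<theta> i) 1)"
      unfolding Suc_eq mult.assoc shift ..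
    also have "\<dots> = X * tau_op scale X \<theta> (Suc i)" unfolding Suc Suc_eq mult.assoc ..
    finally show ?case .
  qed (simp add: tau_op_def)
  have "act (tau_op scale X \<theta> (Suc i)) v = act (tau_op scale X \<theta> i) (act X v - \<theta> i \<star> v)"
    by (simp only: Suc_eq act_mult act_shift)
  also have "\<dots> = act (tau_op scale X \<theta> i * X) v - \<theta> i \<star> act (tau_op scale X \<theta> i) v"
    by (simp only: act_diff act_scale act_mult)
  also have "\<dots> = newton smul (act X) \<theta> (Suc i) v"
    by (simp only: comm act_mult Suc newton.simps)
  finally show ?case .
qed

text \<open>Here the new factor enters on the left, as in \<open>newton\<close>. The bound
  \<open>i \<le> d\<close> keeps \<open>d - i\<close> from being truncated.\<close>

lemma act_sigma_op:
  assumes "i \<le> d"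
  shows "act (sigma_op scale d X \<theta> i) v = newton smul (act X) (\<lambda>h. \<theta> (d - h)) i v"
  using assms
proof (induction i)
  case 0
  then show ?case by (simp add: sigma_op_def act_one)
next
  case (Suc i)
  then have "[d - i..<d + 1] = (d - i) # [d - i + 1..<d + 1]" by (simp add: upt_conv_Cons del: upt_Suc)
  moreover have "d - Suc i + 1 = d - i" using Suc.prems by simp
  ultimately show ?case
    using Suc by (simp add: sigma_op_def act_mult act_shift newton.simps del: upt_Suc)
qed

text \<open>Rewrites sums of eigenspaces as vanishing conditions, the form used in
  \<open>split_part\<close>.\<close>

lemma sum_space_eq:
  assumes op: "spectral_operator smul d (act X) (\<lambda>i. act (E i)) \<theta>" and "J \<subseteq> {..d}"
  shows "sum_space act E J = {v. \<forall>j\<le>d. j \<notin> J \<longrightarrow> act (E j) v = 0}"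
proof -
  interpret spectral_operator smul d "act X" "\<lambda>i. act (E i)" \<theta> by (rule op)
  have fin: "finite J" using \<open>J \<subseteq> {..d}\<close> by (rule finite_subset) simp
  show ?thesis
  proof (intro equalityI subsetI)
    fix v assume "v \<in> sum_space act E J"
    then obtain w where v: "v = (\<Sum>h\<in>J. act (E h) (w h))" by (auto simp: sum_space_def)
    have "act (E j) v = 0" if "j \<le> d" "j \<notin> J" for j
      unfolding v P_linear(3) using that \<open>J \<subseteq> {..d}\<close> P_P by (intro sum.neutral) fastforce
    then show "v \<in> {v. \<forall>j\<le>d. j \<notin> J \<longrightarrow> act (E j) v = 0}" by blast
  next
    fix v assume v: "v \<in> {v. \<forall>j\<le>d. j \<notin> J \<longrightarrow> act (E j) v = 0}"
    have "v = (\<Sum>h\<le>d. act (E h) v)" by (simp add: P_sum)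
    also have "\<dots> = (\<Sum>h\<in>J. act (E h) v)"
      using v \<open>J \<subseteq> {..d}\<close> by (intro sum.mono_neutral_right) auto
    finally show "v \<in> sum_space act E J"
      unfolding sum_space_def by (intro CollectI exI[of _ "\<lambda>_. v"] conjI TrueI)
  qed
qed

lemma first_split_eq:
  assumes op: "spectral_operator smul d (act A) (\<lambda>i. act (E i)) \<theta>"
    and op': "spectral_operator smul d (act As) (\<lambda>i. act (Es i)) \<theta>s"
    and \<theta>: "\<theta> = eigenvalue_seq scale A E" "\<theta>s = eigenvalue_seq scale As Es"
    and "i \<le> d"
  shows "first_split scale act d A E As Es i =
    split_scalar smul d (act A) (\<lambda>i. act (E i)) \<theta> (act As) (\<lambda>i. act (Es i)) \<theta>s i"
proof -
  have "split_space act d E Es i = split_part d (\<lambda>i. act (E i)) (\<lambda>i. act (Es i)) i"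
    using \<open>i \<le> d\<close> by (auto simp: split_space_def split_part_def sum_space_eq[OF op] sum_space_eq[OF op'])
  then show ?thesis
    by (simp add: first_split_def split_scalar_def \<theta> act_mult act_shift Let_def)
qed

text \<open>The functions \<open>t'\<close>, \<open>ts'\<close> and \<open>\<phi>\<close> need agree
  with the data only on the relevant indices, so that double reversals such as
  \<open>d - (d - i)\<close> disappear when the lemma is applied to a relative.\<close>

lemma split_basis_matrices:
  assumes L: "leonard_operators smul d (act X) P t (act Y) Q ts" and y: "Q 0 y = y" "y \<noteq> 0"
    and v: "\<And>i. i \<le> d \<Longrightarrow> v i = newton smul (act X) t i y"
    and t: "\<And>i. i \<le> d \<Longrightarrow> t i = t' i" "\<And>i. i \<le> d \<Longrightarrow> ts i = ts' i"
    and \<phi>: "\<And>i. \<lbrakk>1 \<le> i; i \<le> d\<rbrakk> \<Longrightarrow> split_scalar smul d (act X) P t (act Y) Q ts i = \<phi> i"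
  shows "rep_matrix scale act d X v = tridiag d (\<lambda>i. 1) t' (\<lambda>i. 0)"
    and "rep_matrix scale act d Y v = tridiag d (\<lambda>i. 0) ts' \<phi>"
  using leonard_operators.split_basis_represents[OF L y]
  by (auto intro!: rep_matrix_eq elim!: represents_cong simp: v t \<phi>)

lemma split_basis_matrices_reversed:
  assumes L: "leonard_operators smul d (act X) P t (act Y) Q ts" and y: "Q 0 y = y" "y \<noteq> 0"
    and v: "\<And>i. i \<le> d \<Longrightarrow> v i = newton smul (act X) t (d - i) y"
    and t: "\<And>i. i \<le> d \<Longrightarrow> t (d - i) = t' i" "\<And>i. i \<le> d \<Longrightarrow> ts (d - i) = ts' i"
    and \<phi>: "\<And>i. \<lbrakk>1 \<le> i; i \<le> d\<rbrakk> \<Longrightarrow>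
      split_scalar smul d (act X) P t (act Y) Q ts (d - i + 1) = \<phi> i"
  shows "rep_matrix scale act d X v = tridiag d (\<lambda>i. 0) t' (\<lambda>i. 1)"
    and "rep_matrix scale act d Y v = tridiag d \<phi> ts' (\<lambda>i. 0)"
  by (rule rep_matrix_eq,
      rule represents_cong[OF represents_reverse[OF leonard_operators.split_basis_represents(1)[OF L y]]],
      simp_all only: v t)
    (rule rep_matrix_eq,
      rule represents_cong[OF represents_reverse[OF leonard_operators.split_basis_represents(2)[OF L y]]],
      simp_all only: v t \<phi>)

lemma eigenbasis_matrices:
  assumes L: "leonard_operators smul d (act X) P t (act Y) Q ts" and y: "Q 0 y = y" "y \<noteq> 0"
    and a: "\<And>i x. i \<le> d \<Longrightarrow> P i (act Y (P i x)) = a i \<star> P i x"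
    and v: "\<And>i. i \<le> d \<Longrightarrow> v i = P i y"
    and \<phi>: "\<And>i. \<lbrakk>1 \<le> i; i \<le> d\<rbrakk> \<Longrightarrow> split_scalar smul d (act X) P t (act Y) Q ts i = \<phi> i"
    and \<phi>': "\<And>i. \<lbrakk>1 \<le> i; i \<le> d\<rbrakk> \<Longrightarrow>
      split_scalar smul d (act X) (\<lambda>i. P (d - i)) (\<lambda>i. t (d - i)) (act Y) Q ts (d - i + 1) = \<phi>' i"
  shows "rep_matrix scale act d X v = tridiag d (\<lambda>i. 0) t (\<lambda>i. 0)"
    and "rep_matrix scale act d Y v = tridiag d
      (\<lambda>i. \<phi>' i * ((\<Prod>h\<in>{i + 1..d}. t i - t h) / (\<Prod>h\<in>{i..d}. t (i - 1) - t h))) a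
      (\<lambda>i. \<phi> i * ((\<Prod>h\<in>{0..<i - 1}. t (i - 1) - t h) / (\<Prod>h\<in>{0..<i}. t i - t h)))"
  by (rule rep_matrix_eq,
      rule represents_cong[OF leonard_operators.eigenbasis_represents(1)[OF L y a \<phi> \<phi>']];
      simp only: v)+
    (rule rep_matrix_eq,
      rule represents_cong[OF leonard_operators.eigenbasis_represents(2)[OF L y a \<phi> \<phi>']];
      simp only: v)+

lemma eigenbasis_matrices_reversed:
  assumes L: "leonard_operators smul d (act X) P t (act Y) Q ts" and y: "Q 0 y = y" "y \<noteq> 0"
    and a: "\<And>i x. i \<le> d \<Longrightarrow> P i (act Y (P i x)) = a i \<star> P i x"
    and v: "\<And>i. i \<le> d \<Longrightarrow> v i = P (d - i) y"
    and \<phi>: "\<And>i. \<lbrakk>1 \<le> i; i \<le> d\<rbrakk> \<Longrightarrow>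
      split_scalar smul d (act X) P t (act Y) Q ts (d - i + 1) = \<phi> i"
    and \<phi>': "\<And>i. \<lbrakk>1 \<le> i; i \<le> d\<rbrakk> \<Longrightarrow>
      split_scalar smul d (act X) (\<lambda>i. P (d - i)) (\<lambda>i. t (d - i)) (act Y) Q ts i = \<phi>' i"
  shows "rep_matrix scale act d X v = tridiag d (\<lambda>i. 0) (\<lambda>i. t (d - i)) (\<lambda>i. 0)"
    and "rep_matrix scale act d Y v = tridiag d
      (\<lambda>i. \<phi> i * ((\<Prod>h\<in>{0..<d - i}. t (d - i) - t h) / (\<Prod>h\<in>{0..<d - i + 1}. t (d - i + 1) - t h)))
      (\<lambda>i. a (d - i))
      (\<lambda>i. \<phi>' i * ((\<Prod>h\<in>{d - i + 2..d}. t (d - i + 1) - t h) / (\<Prod>h\<in>{d - i + 1..d}. t (d - i) - t h)))"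
proof -
  have idx: "1 \<le> d - i + 1" "d - i + 1 \<le> d" "d - (d - i + 1) + 1 = i" if "1 \<le> i" "i \<le> d" for i
    using that by auto
  \<comment> \<open>The index map \<open>i\<close> to \<open>d - i + 1\<close> is an involution on
    \<open>1\<close>, ..., \<open>d\<close>; the assumptions are transported along it to fit the
    unreversed eigenbasis.\<close>
  have \<phi>1: "split_scalar smul d (act X) P t (act Y) Q ts i = \<phi> (d - i + 1)" if "1 \<le> i" "i \<le> d" for i
    using \<phi>[OF idx(1,2)[OF that]] unfolding idx(3)[OF that] .
  have \<phi>2: "split_scalar smul d (act X) (\<lambda>i. P (d - i)) (\<lambda>i. t (d - i)) (act Y) Q ts (d - i + 1)
      = \<phi>' (d - i + 1)" if "1 \<le> i" "i \<le> d" for i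
    using \<phi>'[OF idx(1,2)[OF that]] .
  note rep = leonard_operators.eigenbasis_represents[OF L y a \<phi>1 \<phi>2, THEN represents_reverse]
  show "rep_matrix scale act d X v = tridiag d (\<lambda>i. 0) (\<lambda>i. t (d - i)) (\<lambda>i. 0)"
    by (rule rep_matrix_eq, rule represents_cong[OF rep(1)]) (simp_all add: v)
  show "rep_matrix scale act d Y v = tridiag d
      (\<lambda>i. \<phi> i * ((\<Prod>h\<in>{0..<d - i}. t (d - i) - t h) / (\<Prod>h\<in>{0..<d - i + 1}. t (d - i + 1) - t h)))
      (\<lambda>i. a (d - i))
      (\<lambda>i. \<phi>' i * ((\<Prod>h\<in>{d - i + 2..d}. t (d - i + 1) - t h) / (\<Prod>h\<in>{d - i + 1..d}. t (d - i) - t h)))"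
  proof (rule rep_matrix_eq, rule represents_cong[OF rep(2)])
    fix i assume i: "1 \<le> i" "i \<le> d"
    have idx': "d - i + 1 - 1 = d - i" "d - i + 1 + 1 = d - i + 2" by simp_all
    show "\<phi> (d - (d - i + 1) + 1) * ((\<Prod>h\<in>{0..<d - i + 1 - 1}. t (d - i + 1 - 1) - t h)
        / (\<Prod>h\<in>{0..<d - i + 1}. t (d - i + 1) - t h)) =
      \<phi> i * ((\<Prod>h\<in>{0..<d - i}. t (d - i) - t h) / (\<Prod>h\<in>{0..<d - i + 1}. t (d - i + 1) - t h))"
      unfolding idx(3)[OF i] idx' ..
    show "\<phi>' (d - (d - i + 1) + 1) * ((\<Prod>h\<in>{d - i + 1 + 1..d}. t (d - i + 1) - t h)
        / (\<Prod>h\<in>{d - i + 1..d}. t (d - i + 1 - 1) - t h)) =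
      \<phi>' i * ((\<Prod>h\<in>{d - i + 2..d}. t (d - i + 1) - t h) / (\<Prod>h\<in>{d - i + 1..d}. t (d - i) - t h))"
      unfolding idx(3)[OF i] idx' ..
  qed (simp_all add: v)
qed

end

section \<open>The pair of operators attached to a Leonard system\<close>

locale leonard_module = leonard_system scale d A E As Es + irreducible_module act
  for scale :: "'k::field \<Rightarrow> 'a::ring_1 \<Rightarrow> 'a" and d A E As Es
    and act :: "'a \<Rightarrow> 'v::ab_group_add \<Rightarrow> 'v"
begin

sublocale algebra_module scale d act ..

sublocale leonard_operators smul d "act A" "\<lambda>i. act (E i)" "eigenvalue_seq scale A E" "act As" "\<lambda>i. act (Es i)" "eigenvalue_seq scale As Es"
proof -
  interpret A: spectral_operator smul d "act A" "\<lambda>i. act (E i)" "eigenvalue_seq scale A E"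
    by (rule spectral_operator_act[OF multiplicity_free idempotents])
  interpret B: spectral_operator smul d "act As" "\<lambda>i. act (Es i)" "eigenvalue_seq scale As Es"
    by (rule spectral_operator_act[OF multiplicity_free_star idempotents_star])
  \<comment> \<open>A nonzero triple product in the algebra acts nontrivially on some vector because
    the module is faithful.\<close>
  have nz: "\<exists>x. act X (act Y (act Z x)) \<noteq> 0" if "X * Y * Z \<noteq> 0" for X Y Z
    using that act_faithful[of "X * Y * Z" 0] by (auto simp: act_mult act_zero)
  have zero: "act X (act Y (act Z x)) = 0" if "X * Y * Z = 0" for X Y Z x
    using that act_zero(1)[of x] by (simp flip: act_mult add: mult.assoc)
  show "leonard_operators smul d (act A) (\<lambda>i. act (E i)) (eigenvalue_seq scale A E) (act As) (\<lambda>i. act (Es i)) (eigenvalue_seq scale As Es)"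
    by unfold_locales
      (rule zero nz; rule E_As_E_zero Es_A_Es_zero E_As_E_nonzero Es_A_Es_nonzero; auto)+
qed

text \<open>Faithfulness turns the rank-one property of the operator into one of the algebra element
  \<open>F i\<close>, to which \<open>alg_trace_rank_one\<close> applies. It serves both the
  \<open>E i\<close> and the \<open>Es i\<close>.\<close>

lemma act_trace:
  assumes op: "spectral_operator smul d (act X) (\<lambda>i. act (F i)) \<theta>'" and "i \<le> d"
  shows "act (F i) (act Y (act (F i) x)) = alg_trace scale d (Y * F i) \<star> act (F i) x"
proof -
  interpret spectral_operator smul d "act X" "\<lambda>i. act (F i)" \<theta>' by (rule op)
  obtain y where y: "act (F i) y \<noteq> 0" using P_nz[OF \<open>i \<le> d\<close>] by blast
  have "F i * F i = F i"
    by (rule act_faithful) (use P_P[of i i] \<open>i \<le> d\<close> in \<open>simp add: act_mult\<close>)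
  moreover have "F i \<noteq> 0" using y act_zero by auto
  moreover have "\<exists>c. F i * Z * F i = scale c (F i)" for Z
  proof -
    obtain c where c: "act (F i) (act Z (act (F i) y)) = c \<star> act (F i) y"
      using rank_one[OF \<open>i \<le> d\<close> y] by blast
    have "act (F i * Z * F i) x = act (scale c (F i)) x" for x
    proof -
      obtain b where b: "act (F i) x = b \<star> act (F i) y" using rank_one[OF \<open>i \<le> d\<close> y] by blast
      then show ?thesis by (simp add: act_mult act_scale c mult.commute)
    qed
    then show ?thesis using act_faithful by blast
  qed
  ultimately have "F i * Y * F i = scale (alg_trace scale d (Y * F i)) (F i)"
    by (rule alg_trace_rank_one)
  then show ?thesis by (metis act_mult act_scale(1))
qed

end

section \<open>The 24 bases as bases of the eight relatives\<close>

theorem theorem11p2: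
  fixes scale :: "'k::field \<Rightarrow> 'a::ring_1 \<Rightarrow> 'a" and d :: nat
    and act :: "'a \<Rightarrow> 'v::ab_group_add \<Rightarrow> 'v"
    and A As :: 'a and E Es :: "nat \<Rightarrow> 'a"
    and \<theta> \<theta>s \<phi>1 \<phi>2 a as :: "nat \<Rightarrow> 'k"
    and \<eta>0 \<eta>d \<eta>0s \<eta>ds :: 'v
    and Ag Asg :: "symb list \<Rightarrow> 'k mat"
  assumes "leonard_system scale d A E As Es"
    and "irreducible_module act"
    and "\<theta> = eigenvalue_seq scale A E"
    and "\<theta>s = eigenvalue_seq scale As Es"
    and "\<phi>1 = first_split scale act d A E As Es"
    and "\<phi>2 = second_split scale act d A E As Es"
    and "a = (\<lambda>i. alg_trace scale d (A * Es i))"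
    and "as = (\<lambda>i. alg_trace scale d (As * E i))"
    and "\<eta>0 \<in> range (act (E 0))" and "\<eta>0 \<noteq> 0"
    and "\<eta>d \<in> range (act (E d))" and "\<eta>d \<noteq> 0"
    and "\<eta>0s \<in> range (act (Es 0))" and "\<eta>0s \<noteq> 0"
    and "\<eta>ds \<in> range (act (Es d))" and "\<eta>ds \<noteq> 0"
    and "Ag = (\<lambda>g. rep_matrix scale act d A (basis24 scale act d A E As Es \<eta>0 \<eta>d \<eta>0s \<eta>ds g))"
    and "Asg = (\<lambda>g. rep_matrix scale act d As (basis24 scale act d A E As Es \<eta>0 \<eta>d \<eta>0s \<eta>ds g))"
  shows
    "Ag [Sds, S0, S0s, Sd] = tridiag d (\<lambda>i. 1) (\<lambda>i. \<theta> i) (\<lambda>i. 0) \<and>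
     Asg [Sds, S0, S0s, Sd] = tridiag d (\<lambda>i. 0) (\<lambda>i. \<theta>s i) (\<lambda>i. \<phi>1 i) \<and>
     Ag [S0, Sds, S0s, Sd] = tridiag d (\<lambda>i. \<phi>1 i) (\<lambda>i. \<theta> i) (\<lambda>i. 0) \<and>
     Asg [S0, Sds, S0s, Sd] = tridiag d (\<lambda>i. 0) (\<lambda>i. \<theta>s i) (\<lambda>i. 1) \<and>
     Ag [Sds, S0, Sd, S0s] = tridiag d (\<lambda>i. 0) (\<lambda>i. \<theta> (d - i)) (\<lambda>i. 1) \<and>
     Asg [Sds, S0, Sd, S0s] = tridiag d (\<lambda>i. \<phi>1 (d - i + 1)) (\<lambda>i. \<theta>s (d - i)) (\<lambda>i. 0) \<and>
     Ag [S0, Sds, Sd, S0s] = tridiag d (\<lambda>i. 0) (\<lambda>i. \<theta> (d - i)) (\<lambda>i. \<phi>1 (d - i + 1)) \<and>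
     Asg [S0, Sds, Sd, S0s] = tridiag d (\<lambda>i. 1) (\<lambda>i. \<theta>s (d - i)) (\<lambda>i. 0) \<and>
     Ag [Sd, S0s, S0, Sds] = tridiag d (\<lambda>i. 0) (\<lambda>i. \<theta> i) (\<lambda>i. \<phi>1 i) \<and>
     Asg [Sd, S0s, S0, Sds] = tridiag d (\<lambda>i. 1) (\<lambda>i. \<theta>s i) (\<lambda>i. 0) \<and>
     Ag [S0s, Sd, S0, Sds] = tridiag d (\<lambda>i. 0) (\<lambda>i. \<theta> i) (\<lambda>i. 1) \<and>
     Asg [S0s, Sd, S0, Sds] = tridiag d (\<lambda>i. \<phi>1 i) (\<lambda>i. \<theta>s i) (\<lambda>i. 0) \<and>
     Ag [Sd, S0s, Sds, S0] = tridiag d (\<lambda>i. \<phi>1 (d - i + 1)) (\<lambda>i. \<theta> (d - i)) (\<lambda>i. 0) \<and>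
     Asg [Sd, S0s, Sds, S0] = tridiag d (\<lambda>i. 0) (\<lambda>i. \<theta>s (d - i)) (\<lambda>i. 1) \<and>
     Ag [S0s, Sd, Sds, S0] = tridiag d (\<lambda>i. 1) (\<lambda>i. \<theta> (d - i)) (\<lambda>i. 0) \<and>
     Asg [S0s, Sd, Sds, S0] = tridiag d (\<lambda>i. 0) (\<lambda>i. \<theta>s (d - i)) (\<lambda>i. \<phi>1 (d - i + 1)) \<and>
     Ag [Sd, Sds, S0, S0s] = tridiag d (\<lambda>i. 0) (\<lambda>i. \<theta> i) (\<lambda>i. \<phi>2 (d - i + 1)) \<and>
     Asg [Sd, Sds, S0, S0s] = tridiag d (\<lambda>i. 1) (\<lambda>i. \<theta>s (d - i)) (\<lambda>i. 0) \<and>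
     Ag [Sds, Sd, S0, S0s] = tridiag d (\<lambda>i. 0) (\<lambda>i. \<theta> i) (\<lambda>i. 1) \<and>
     Asg [Sds, Sd, S0, S0s] = tridiag d (\<lambda>i. \<phi>2 (d - i + 1)) (\<lambda>i. \<theta>s (d - i)) (\<lambda>i. 0) \<and>
     Ag [Sd, Sds, S0s, S0] = tridiag d (\<lambda>i. \<phi>2 i) (\<lambda>i. \<theta> (d - i)) (\<lambda>i. 0) \<and>
     Asg [Sd, Sds, S0s, S0] = tridiag d (\<lambda>i. 0) (\<lambda>i. \<theta>s i) (\<lambda>i. 1) \<and>
     Ag [Sds, Sd, S0s, S0] = tridiag d (\<lambda>i. 1) (\<lambda>i. \<theta> (d - i)) (\<lambda>i. 0) \<and>
     Asg [Sds, Sd, S0s, S0] = tridiag d (\<lambda>i. 0) (\<lambda>i. \<theta>s i) (\<lambda>i. \<phi>2 i) \<and>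
     Ag [S0, S0s, Sd, Sds] = tridiag d (\<lambda>i. 0) (\<lambda>i. \<theta> (d - i)) (\<lambda>i. \<phi>2 i) \<and>
     Asg [S0, S0s, Sd, Sds] = tridiag d (\<lambda>i. 1) (\<lambda>i. \<theta>s i) (\<lambda>i. 0) \<and>
     Ag [S0s, S0, Sd, Sds] = tridiag d (\<lambda>i. 0) (\<lambda>i. \<theta> (d - i)) (\<lambda>i. 1) \<and>
     Asg [S0s, S0, Sd, Sds] = tridiag d (\<lambda>i. \<phi>2 i) (\<lambda>i. \<theta>s i) (\<lambda>i. 0) \<and>
     Ag [S0, S0s, Sds, Sd] = tridiag d (\<lambda>i. \<phi>2 (d - i + 1)) (\<lambda>i. \<theta> i) (\<lambda>i. 0) \<and>
     Asg [S0, S0s, Sds, Sd] = tridiag d (\<lambda>i. 0) (\<lambda>i. \<theta>s (d - i)) (\<lambda>i. 1) \<and>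
     Ag [S0s, S0, Sds, Sd] = tridiag d (\<lambda>i. 1) (\<lambda>i. \<theta> i) (\<lambda>i. 0) \<and>
     Asg [S0s, S0, Sds, Sd] = tridiag d (\<lambda>i. 0) (\<lambda>i. \<theta>s (d - i)) (\<lambda>i. \<phi>2 (d - i + 1)) \<and>
     Ag [Sds, S0s, S0, Sd] = tridiag d (\<lambda>i. 0) (\<lambda>i. \<theta> i) (\<lambda>i. 0) \<and>
     Asg [Sds, S0s, S0, Sd] = tridiag d
        (\<lambda>i. \<phi>2 (d - i + 1) * ((\<Prod>h\<in>{i + 1..d}. \<theta> i - \<theta> h) / (\<Prod>h\<in>{i..d}. \<theta> (i - 1) - \<theta> h)))
        (\<lambda>i. as i)
        (\<lambda>i. \<phi>1 i * ((\<Prod>h\<in>{0..<i - 1}. \<theta> (i - 1) - \<theta> h) / (\<Prod>h\<in>{0..<i}. \<theta> i - \<theta> h))) \<and>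
     Ag [S0s, Sds, S0, Sd] = tridiag d (\<lambda>i. 0) (\<lambda>i. \<theta> i) (\<lambda>i. 0) \<and>
     Asg [S0s, Sds, S0, Sd] = tridiag d
        (\<lambda>i. \<phi>1 i * ((\<Prod>h\<in>{i + 1..d}. \<theta> i - \<theta> h) / (\<Prod>h\<in>{i..d}. \<theta> (i - 1) - \<theta> h)))
        (\<lambda>i. as i)
        (\<lambda>i. \<phi>2 (d - i + 1) * ((\<Prod>h\<in>{0..<i - 1}. \<theta> (i - 1) - \<theta> h) / (\<Prod>h\<in>{0..<i}. \<theta> i - \<theta> h))) \<and>
     Ag [Sds, S0s, Sd, S0] = tridiag d (\<lambda>i. 0) (\<lambda>i. \<theta> (d - i)) (\<lambda>i. 0) \<and>
     Asg [Sds, S0s, Sd, S0] = tridiag d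
        (\<lambda>i. \<phi>1 (d - i + 1) * ((\<Prod>h\<in>{0..<d - i}. \<theta> (d - i) - \<theta> h) / (\<Prod>h\<in>{0..<d - i + 1}. \<theta> (d - i + 1) - \<theta> h)))
        (\<lambda>i. as (d - i))
        (\<lambda>i. \<phi>2 i * ((\<Prod>h\<in>{d - i + 2..d}. \<theta> (d - i + 1) - \<theta> h) / (\<Prod>h\<in>{d - i + 1..d}. \<theta> (d - i) - \<theta> h))) \<and>
     Ag [S0s, Sds, Sd, S0] = tridiag d (\<lambda>i. 0) (\<lambda>i. \<theta> (d - i)) (\<lambda>i. 0) \<and>
     Asg [S0s, Sds, Sd, S0] = tridiag d
        (\<lambda>i. \<phi>2 i * ((\<Prod>h\<in>{0..<d - i}. \<theta> (d - i) - \<theta> h) / (\<Prod>h\<in>{0..<d - i + 1}. \<theta> (d - i + 1) - \<theta> h)))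
        (\<lambda>i. as (d - i))
        (\<lambda>i. \<phi>1 (d - i + 1) * ((\<Prod>h\<in>{d - i + 2..d}. \<theta> (d - i + 1) - \<theta> h) / (\<Prod>h\<in>{d - i + 1..d}. \<theta> (d - i) - \<theta> h))) \<and>
     Ag [Sd, S0, S0s, Sds] = tridiag d
        (\<lambda>i. \<phi>2 i * ((\<Prod>h\<in>{i + 1..d}. \<theta>s i - \<theta>s h) / (\<Prod>h\<in>{i..d}. \<theta>s (i - 1) - \<theta>s h)))
        (\<lambda>i. a i)
        (\<lambda>i. \<phi>1 i * ((\<Prod>h\<in>{0..<i - 1}. \<theta>s (i - 1) - \<theta>s h) / (\<Prod>h\<in>{0..<i}. \<theta>s i - \<theta>s h))) \<and>
     Asg [Sd, S0, S0s, Sds] = tridiag d (\<lambda>i. 0) (\<lambda>i. \<theta>s i) (\<lambda>i. 0) \<and>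
     Ag [S0, Sd, S0s, Sds] = tridiag d
        (\<lambda>i. \<phi>1 i * ((\<Prod>h\<in>{i + 1..d}. \<theta>s i - \<theta>s h) / (\<Prod>h\<in>{i..d}. \<theta>s (i - 1) - \<theta>s h)))
        (\<lambda>i. a i)
        (\<lambda>i. \<phi>2 i * ((\<Prod>h\<in>{0..<i - 1}. \<theta>s (i - 1) - \<theta>s h) / (\<Prod>h\<in>{0..<i}. \<theta>s i - \<theta>s h))) \<and>
     Asg [S0, Sd, S0s, Sds] = tridiag d (\<lambda>i. 0) (\<lambda>i. \<theta>s i) (\<lambda>i. 0) \<and>
     Ag [Sd, S0, Sds, S0s] = tridiag d
        (\<lambda>i. \<phi>1 (d - i + 1) * ((\<Prod>h\<in>{0..<d - i}. \<theta>s (d - i) - \<theta>s h) / (\<Prod>h\<in>{0..<d - i + 1}. \<theta>s (d - i + 1) - \<theta>s h)))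
        (\<lambda>i. a (d - i))
        (\<lambda>i. \<phi>2 (d - i + 1) * ((\<Prod>h\<in>{d - i + 2..d}. \<theta>s (d - i + 1) - \<theta>s h) / (\<Prod>h\<in>{d - i + 1..d}. \<theta>s (d - i) - \<theta>s h))) \<and>
     Asg [Sd, S0, Sds, S0s] = tridiag d (\<lambda>i. 0) (\<lambda>i. \<theta>s (d - i)) (\<lambda>i. 0) \<and>
     Ag [S0, Sd, Sds, S0s] = tridiag d
        (\<lambda>i. \<phi>2 (d - i + 1) * ((\<Prod>h\<in>{0..<d - i}. \<theta>s (d - i) - \<theta>s h) / (\<Prod>h\<in>{0..<d - i + 1}. \<theta>s (d - i + 1) - \<theta>s h)))
        (\<lambda>i. a (d - i))
        (\<lambda>i. \<phi>1 (d - i + 1) * ((\<Prod>h\<in>{d - i + 2..d}. \<theta>s (d - i + 1) - \<theta>s h) / (\<Prod>h\<in>{d - i + 1..d}. \<theta>s (d - i) - \<theta>s h))) \<and>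
     Asg [S0, Sd, Sds, S0s] = tridiag d (\<lambda>i. 0) (\<lambda>i. \<theta>s (d - i)) (\<lambda>i. 0)"
proof -
  interpret leonard_module scale d A E As Es act
    using assms(1,2) by (simp add: leonard_module_def)
  note names = assms(3-8)
  note Ag = assms(17) and Asg = assms(18)
  \<comment> \<open>The form \<open>d - 0\<close> makes \<open>yd\<close> and \<open>yds\<close>
    instances of \<open>Q 0 y = y\<close> for the reversed orderings.\<close>
  have y0: "act (E 0) \<eta>0 = \<eta>0" "\<eta>0 \<noteq> 0"
    and yd: "act (E (d - 0)) \<eta>d = \<eta>d" "\<eta>d \<noteq> 0"
    and y0s: "act (Es 0) \<eta>0s = \<eta>0s" "\<eta>0s \<noteq> 0"
    and yds: "act (Es (d - 0)) \<eta>ds = \<eta>ds" "\<eta>ds \<noteq> 0"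
    using assms(9-16) A.P_P[of 0 0] A.P_P[of d d] B.P_P[of 0 0] B.P_P[of d d] by auto
  \<comment> \<open>The eight relatives: \<open>L2\<close> reverses the \<open>E i\<close>,
    \<open>L3\<close> the \<open>Es i\<close>, \<open>L4\<close> both, and each \<open>D\<close>
    exchanges \<open>A\<close> and \<open>As\<close> in the corresponding \<open>L\<close>.\<close>
  note L = leonard_operators_axioms[folded names(1,2)]
  note L2 = leonard_operators.reverse_left[OF L]
  note L3 = leonard_operators.reverse_right[OF L]
  note L4 = leonard_operators.reverse_right[OF L2]
  note D1 = leonard_operators.dual[OF L]
  note D2 = leonard_operators.dual[OF L2]
  note D3 = leonard_operators.dual[OF L3]
  note D4 = leonard_operators.dual[OF L4]
  note op = leonard_operators.axioms(1,2)
  have s1: "split_scalar (vscale scale act) d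
      (act A) (\<lambda>i. act (E i)) \<theta> (act As) (\<lambda>i. act (Es i)) \<theta>s i = \<phi>1 i" if "1 \<le> i" "i \<le> d" for i
    unfolding names(3) using that by (intro first_split_eq[symmetric] op[OF L] names(1,2))
  have s2: "split_scalar (vscale scale act) d
      (act A) (\<lambda>i. act (E (d - i))) (\<lambda>i. \<theta> (d - i)) (act As) (\<lambda>i. act (Es i)) \<theta>s i = \<phi>2 i" if "1 \<le> i" "i \<le> d" for i
    unfolding names(4) second_split_def using that
    by (intro first_split_eq[symmetric] op[OF L2]) (simp_all add: names(1,2) eigenvalue_seq_def fun_eq_iff)
  \<comment> \<open>Some applications ask for a split scalar at \<open>d - i + 1\<close>; if its
    value at \<open>i\<close> is \<open>g (d - i + 1)\<close>, the two reversals cancel to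
    \<open>g i\<close>.\<close>
  have flip: "f (d - i + 1) = g i" if "\<And>i. \<lbrakk>1 \<le> i; i \<le> d\<rbrakk> \<Longrightarrow> f i = g (d - i + 1)" "1 \<le> i" "i \<le> d"
    for f g :: "nat \<Rightarrow> 'k" and i
  proof -
    have "1 \<le> d - i + 1" "d - i + 1 \<le> d" "d - (d - i + 1) + 1 = i" using that(2,3) by auto
    then show ?thesis using that(1)[of "d - i + 1"] by simp
  qed
  have s3: "split_scalar (vscale scale act) d
      (act A) (\<lambda>i. act (E i)) \<theta> (act As) (\<lambda>i. act (Es (d - i))) (\<lambda>i. \<theta>s (d - i)) i = \<phi>2 (d - i + 1)" if "1 \<le> i" "i \<le> d" for i
    using leonard_operators.split_scalar_reverse_right[OF L that] s2[of "d - i + 1"] that by simp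
  have s4: "split_scalar (vscale scale act) d
      (act A) (\<lambda>i. act (E (d - i))) (\<lambda>i. \<theta> (d - i)) (act As) (\<lambda>i. act (Es (d - i))) (\<lambda>i. \<theta>s (d - i)) i = \<phi>1 (d - i + 1)" if "1 \<le> i" "i \<le> d" for i
    using leonard_operators.split_scalar_reverse_both[OF L that] s1[of "d - i + 1"] that by simp
  have t1: "split_scalar (vscale scale act) d
      (act As) (\<lambda>i. act (Es i)) \<theta>s (act A) (\<lambda>i. act (E i)) \<theta> i = \<phi>1 i" if "1 \<le> i" "i \<le> d" for i
    using leonard_operators.split_scalar_dual[OF L that] s1[OF that] by (rule trans)
  have t2: "split_scalar (vscale scale act) d
      (act As) (\<lambda>i. act (Es i)) \<theta>s (act A) (\<lambda>i. act (E (d - i))) (\<lambda>i. \<theta> (d - i)) i = \<phi>2 i" if "1 \<le> i" "i \<le> d" for i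
    using leonard_operators.split_scalar_dual[OF L2 that] s2[OF that] by (rule trans)
  have t3: "split_scalar (vscale scale act) d
      (act As) (\<lambda>i. act (Es (d - i))) (\<lambda>i. \<theta>s (d - i)) (act A) (\<lambda>i. act (E i)) \<theta> i = \<phi>2 (d - i + 1)" if "1 \<le> i" "i \<le> d" for i
    using leonard_operators.split_scalar_dual[OF L3 that] s3[OF that] by (rule trans)
  have t4: "split_scalar (vscale scale act) d
      (act As) (\<lambda>i. act (Es (d - i))) (\<lambda>i. \<theta>s (d - i)) (act A) (\<lambda>i. act (E (d - i))) (\<lambda>i. \<theta> (d - i)) i = \<phi>1 (d - i + 1)" if "1 \<le> i" "i \<le> d" for i
    using leonard_operators.split_scalar_dual[OF L4 that] s4[OF that] by (rule trans)
  have up: "f (d - i + 1) = g (d - i + 1)" if "\<And>i. \<lbrakk>1 \<le> i; i \<le> d\<rbrakk> \<Longrightarrow> f i = g i" "1 \<le> i" "i \<le> d"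
    for f g :: "nat \<Rightarrow> 'k" and i
    using that by simp
  note splits = s1 s2 s3 s4 t1 t2 t3 t4
    up[OF s1] up[OF s2] up[OF t1] up[OF t2]
    flip[where g = \<phi>2, OF s3] flip[where g = \<phi>1, OF s4] flip[where g = \<phi>2, OF t3] flip[where g = \<phi>1, OF t4]
  note basis = basis24_def act_tau_op act_sigma_op names(1,2)[symmetric]
  have trE: "act (E i) (act As (act (E i) x)) = vscale scale act (as i) (act (E i) x)"
    and trEs: "act (Es i) (act A (act (Es i) x)) = vscale scale act (a i) (act (Es i) x)" if "i \<le> d" for i x
    unfolding names(5,6) using act_trace that op[OF L] by blast+
  \<comment> \<open>The starting vector and the choice between \<open>\<tau>\<close> and
    \<open>\<sigma>\<close> (starred or not) determine the relative; whether
    \<open>v\<^sub>i\<close> uses \<open>i\<close> or \<open>d - i\<close> factors selects the plain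
    or the reversed lemma.\<close>
  have b0:
      "Ag [Sds, S0, S0s, Sd] = tridiag d (\<lambda>i. 1) (\<lambda>i. \<theta> i) (\<lambda>i. 0)"
      "Asg [Sds, S0, S0s, Sd] = tridiag d
        (\<lambda>i. 0)
        (\<lambda>i. \<theta>s i)
        (\<lambda>i. \<phi>1 i)"
    unfolding Ag Asg by (rule split_basis_matrices[OF L y0s]; (rule splits; assumption | simp add: basis))+
  have b1:
      "Asg [S0, Sds, S0s, Sd] = tridiag d (\<lambda>i. 0) (\<lambda>i. \<theta>s i) (\<lambda>i. 1)"
      "Ag [S0, Sds, S0s, Sd] = tridiag d
        (\<lambda>i. \<phi>1 i)
        (\<lambda>i. \<theta> i)
        (\<lambda>i. 0)"
    unfolding Ag Asg by (rule split_basis_matrices_reversed[OF D4 yd]; (rule splits; assumption | simp add: basis))+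
  have b2:
      "Ag [Sds, S0, Sd, S0s] = tridiag d
        (\<lambda>i. 0)
        (\<lambda>i. \<theta> (d - i))
        (\<lambda>i. 1)"
      "Asg [Sds, S0, Sd, S0s] = tridiag d
        (\<lambda>i. \<phi>1 (d - i + 1))
        (\<lambda>i. \<theta>s (d - i))
        (\<lambda>i. 0)"
    unfolding Ag Asg by (rule split_basis_matrices_reversed[OF L y0s]; (rule splits; assumption | simp add: basis))+
  have b3:
      "Asg [S0, Sds, Sd, S0s] = tridiag d
        (\<lambda>i. 1)
        (\<lambda>i. \<theta>s (d - i))
        (\<lambda>i. 0)"
      "Ag [S0, Sds, Sd, S0s] = tridiag d
        (\<lambda>i. 0)
        (\<lambda>i. \<theta> (d - i))
        (\<lambda>i. \<phi>1 (d - i + 1))"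
    unfolding Ag Asg by (rule split_basis_matrices[OF D4 yd]; (rule splits; assumption | simp add: basis))+
  have b4:
      "Asg [Sd, S0s, S0, Sds] = tridiag d (\<lambda>i. 1) (\<lambda>i. \<theta>s i) (\<lambda>i. 0)"
      "Ag [Sd, S0s, S0, Sds] = tridiag d
        (\<lambda>i. 0)
        (\<lambda>i. \<theta> i)
        (\<lambda>i. \<phi>1 i)"
    unfolding Ag Asg by (rule split_basis_matrices[OF D1 y0]; (rule splits; assumption | simp add: basis))+
  have b5:
      "Ag [S0s, Sd, S0, Sds] = tridiag d (\<lambda>i. 0) (\<lambda>i. \<theta> i) (\<lambda>i. 1)"
      "Asg [S0s, Sd, S0, Sds] = tridiag d
        (\<lambda>i. \<phi>1 i)
        (\<lambda>i. \<theta>s i)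
        (\<lambda>i. 0)"
    unfolding Ag Asg by (rule split_basis_matrices_reversed[OF L4 yds]; (rule splits; assumption | simp add: basis))+
  have b6:
      "Asg [Sd, S0s, Sds, S0] = tridiag d
        (\<lambda>i. 0)
        (\<lambda>i. \<theta>s (d - i))
        (\<lambda>i. 1)"
      "Ag [Sd, S0s, Sds, S0] = tridiag d
        (\<lambda>i. \<phi>1 (d - i + 1))
        (\<lambda>i. \<theta> (d - i))
        (\<lambda>i. 0)"
    unfolding Ag Asg by (rule split_basis_matrices_reversed[OF D1 y0]; (rule splits; assumption | simp add: basis))+
  have b7:
      "Ag [S0s, Sd, Sds, S0] = tridiag d
        (\<lambda>i. 1)
        (\<lambda>i. \<theta> (d - i))
        (\<lambda>i. 0)"
      "Asg [S0s, Sd, Sds, S0] = tridiag d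
        (\<lambda>i. 0)
        (\<lambda>i. \<theta>s (d - i))
        (\<lambda>i. \<phi>1 (d - i + 1))"
    unfolding Ag Asg by (rule split_basis_matrices[OF L4 yds]; (rule splits; assumption | simp add: basis))+
  have b8:
      "Asg [Sd, Sds, S0, S0s] = tridiag d
        (\<lambda>i. 1)
        (\<lambda>i. \<theta>s (d - i))
        (\<lambda>i. 0)"
      "Ag [Sd, Sds, S0, S0s] = tridiag d
        (\<lambda>i. 0)
        (\<lambda>i. \<theta> i)
        (\<lambda>i. \<phi>2 (d - i + 1))"
    unfolding Ag Asg by (rule split_basis_matrices[OF D3 y0]; (rule splits; assumption | simp add: basis))+
  have b9:
      "Ag [Sds, Sd, S0, S0s] = tridiag d (\<lambda>i. 0) (\<lambda>i. \<theta> i) (\<lambda>i. 1)"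
      "Asg [Sds, Sd, S0, S0s] = tridiag d
        (\<lambda>i. \<phi>2 (d - i + 1))
        (\<lambda>i. \<theta>s (d - i))
        (\<lambda>i. 0)"
    unfolding Ag Asg by (rule split_basis_matrices_reversed[OF L2 y0s]; (rule splits; assumption | simp add: basis))+
  have b10:
      "Asg [Sd, Sds, S0s, S0] = tridiag d (\<lambda>i. 0) (\<lambda>i. \<theta>s i) (\<lambda>i. 1)"
      "Ag [Sd, Sds, S0s, S0] = tridiag d
        (\<lambda>i. \<phi>2 i)
        (\<lambda>i. \<theta> (d - i))
        (\<lambda>i. 0)"
    unfolding Ag Asg by (rule split_basis_matrices_reversed[OF D3 y0]; (rule splits; assumption | simp add: basis))+
  have b11:
      "Ag [Sds, Sd, S0s, S0] = tridiag d
        (\<lambda>i. 1)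
        (\<lambda>i. \<theta> (d - i))
        (\<lambda>i. 0)"
      "Asg [Sds, Sd, S0s, S0] = tridiag d
        (\<lambda>i. 0)
        (\<lambda>i. \<theta>s i)
        (\<lambda>i. \<phi>2 i)"
    unfolding Ag Asg by (rule split_basis_matrices[OF L2 y0s]; (rule splits; assumption | simp add: basis))+
  have b12:
      "Asg [S0, S0s, Sd, Sds] = tridiag d (\<lambda>i. 1) (\<lambda>i. \<theta>s i) (\<lambda>i. 0)"
      "Ag [S0, S0s, Sd, Sds] = tridiag d
        (\<lambda>i. 0)
        (\<lambda>i. \<theta> (d - i))
        (\<lambda>i. \<phi>2 i)"
    unfolding Ag Asg by (rule split_basis_matrices[OF D2 yd]; (rule splits; assumption | simp add: basis))+
  have b13:
      "Ag [S0s, S0, Sd, Sds] = tridiag d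
        (\<lambda>i. 0)
        (\<lambda>i. \<theta> (d - i))
        (\<lambda>i. 1)"
      "Asg [S0s, S0, Sd, Sds] = tridiag d
        (\<lambda>i. \<phi>2 i)
        (\<lambda>i. \<theta>s i)
        (\<lambda>i. 0)"
    unfolding Ag Asg by (rule split_basis_matrices_reversed[OF L3 yds]; (rule splits; assumption | simp add: basis))+
  have b14:
      "Asg [S0, S0s, Sds, Sd] = tridiag d
        (\<lambda>i. 0)
        (\<lambda>i. \<theta>s (d - i))
        (\<lambda>i. 1)"
      "Ag [S0, S0s, Sds, Sd] = tridiag d
        (\<lambda>i. \<phi>2 (d - i + 1))
        (\<lambda>i. \<theta> i)
        (\<lambda>i. 0)"
    unfolding Ag Asg by (rule split_basis_matrices_reversed[OF D2 yd]; (rule splits; assumption | simp add: basis))+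
  have b15:
      "Ag [S0s, S0, Sds, Sd] = tridiag d (\<lambda>i. 1) (\<lambda>i. \<theta> i) (\<lambda>i. 0)"
      "Asg [S0s, S0, Sds, Sd] = tridiag d
        (\<lambda>i. 0)
        (\<lambda>i. \<theta>s (d - i))
        (\<lambda>i. \<phi>2 (d - i + 1))"
    unfolding Ag Asg by (rule split_basis_matrices[OF L3 yds]; (rule splits; assumption | simp add: basis))+
  \<comment> \<open>For the eigenbases the starting vector determines the relative:
    \<open>\<eta>0s\<close> gives \<open>L\<close>, \<open>\<eta>ds\<close> gives \<open>L3\<close>,
    \<open>\<eta>0\<close> gives \<open>D1\<close> and \<open>\<eta>d\<close> gives
    \<open>D2\<close>.\<close>
  have b16:
      "Ag [Sds, S0s, S0, Sd] = tridiag d (\<lambda>i. 0) (\<lambda>i. \<theta> i) (\<lambda>i. 0)"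
      "Asg [Sds, S0s, S0, Sd] = tridiag d
        (\<lambda>i. \<phi>2 (d - i + 1) * ((\<Prod>h\<in>{i + 1..d}. \<theta> i - \<theta> h) / (\<Prod>h\<in>{i..d}. \<theta> (i - 1) - \<theta> h)))
        (\<lambda>i. as i)
        (\<lambda>i. \<phi>1 i * ((\<Prod>h\<in>{0..<i - 1}. \<theta> (i - 1) - \<theta> h) / (\<Prod>h\<in>{0..<i}. \<theta> i - \<theta> h)))"
    unfolding Ag Asg by (rule eigenbasis_matrices[OF L y0s trE]; (rule splits; assumption | simp add: basis))+
  have b17:
      "Ag [S0s, Sds, S0, Sd] = tridiag d (\<lambda>i. 0) (\<lambda>i. \<theta> i) (\<lambda>i. 0)"
      "Asg [S0s, Sds, S0, Sd] = tridiag d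
        (\<lambda>i. \<phi>1 i * ((\<Prod>h\<in>{i + 1..d}. \<theta> i - \<theta> h) / (\<Prod>h\<in>{i..d}. \<theta> (i - 1) - \<theta> h)))
        (\<lambda>i. as i)
        (\<lambda>i. \<phi>2 (d - i + 1) * ((\<Prod>h\<in>{0..<i - 1}. \<theta> (i - 1) - \<theta> h) / (\<Prod>h\<in>{0..<i}. \<theta> i - \<theta> h)))"
    unfolding Ag Asg by (rule eigenbasis_matrices[OF L3 yds trE]; (rule splits; assumption | simp add: basis))+
  have b18:
      "Ag [Sds, S0s, Sd, S0] = tridiag d
        (\<lambda>i. 0)
        (\<lambda>i. \<theta> (d - i))
        (\<lambda>i. 0)"
      "Asg [Sds, S0s, Sd, S0] = tridiag d
        (\<lambda>i. \<phi>1 (d - i + 1) * ((\<Prod>h\<in>{0..<d - i}. \<theta> (d - i) - \<theta> h) / (\<Prod>h\<in>{0..<d - i + 1}. \<theta> (d - i + 1) - \<theta> h)))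
        (\<lambda>i. as (d - i))
        (\<lambda>i. \<phi>2 i * ((\<Prod>h\<in>{d - i + 2..d}. \<theta> (d - i + 1) - \<theta> h) / (\<Prod>h\<in>{d - i + 1..d}. \<theta> (d - i) - \<theta> h)))"
    unfolding Ag Asg by (rule eigenbasis_matrices_reversed[OF L y0s trE]; (rule splits; assumption | simp add: basis))+
  have b19:
      "Ag [S0s, Sds, Sd, S0] = tridiag d
        (\<lambda>i. 0)
        (\<lambda>i. \<theta> (d - i))
        (\<lambda>i. 0)"
      "Asg [S0s, Sds, Sd, S0] = tridiag d
        (\<lambda>i. \<phi>2 i * ((\<Prod>h\<in>{0..<d - i}. \<theta> (d - i) - \<theta> h) / (\<Prod>h\<in>{0..<d - i + 1}. \<theta> (d - i + 1) - \<theta> h)))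
        (\<lambda>i. as (d - i))
        (\<lambda>i. \<phi>1 (d - i + 1) * ((\<Prod>h\<in>{d - i + 2..d}. \<theta> (d - i + 1) - \<theta> h) / (\<Prod>h\<in>{d - i + 1..d}. \<theta> (d - i) - \<theta> h)))"
    unfolding Ag Asg by (rule eigenbasis_matrices_reversed[OF L3 yds trE]; (rule splits; assumption | simp add: basis))+
  have b20:
      "Asg [Sd, S0, S0s, Sds] = tridiag d (\<lambda>i. 0) (\<lambda>i. \<theta>s i) (\<lambda>i. 0)"
      "Ag [Sd, S0, S0s, Sds] = tridiag d
        (\<lambda>i. \<phi>2 i * ((\<Prod>h\<in>{i + 1..d}. \<theta>s i - \<theta>s h) / (\<Prod>h\<in>{i..d}. \<theta>s (i - 1) - \<theta>s h)))
        (\<lambda>i. a i)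
        (\<lambda>i. \<phi>1 i * ((\<Prod>h\<in>{0..<i - 1}. \<theta>s (i - 1) - \<theta>s h) / (\<Prod>h\<in>{0..<i}. \<theta>s i - \<theta>s h)))"
    unfolding Ag Asg by (rule eigenbasis_matrices[OF D1 y0 trEs]; (rule splits; assumption | simp add: basis))+
  have b21:
      "Asg [S0, Sd, S0s, Sds] = tridiag d (\<lambda>i. 0) (\<lambda>i. \<theta>s i) (\<lambda>i. 0)"
      "Ag [S0, Sd, S0s, Sds] = tridiag d
        (\<lambda>i. \<phi>1 i * ((\<Prod>h\<in>{i + 1..d}. \<theta>s i - \<theta>s h) / (\<Prod>h\<in>{i..d}. \<theta>s (i - 1) - \<theta>s h)))
        (\<lambda>i. a i)
        (\<lambda>i. \<phi>2 i * ((\<Prod>h\<in>{0..<i - 1}. \<theta>s (i - 1) - \<theta>s h) / (\<Prod>h\<in>{0..<i}. \<theta>s i - \<theta>s h)))"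
    unfolding Ag Asg by (rule eigenbasis_matrices[OF D2 yd trEs]; (rule splits; assumption | simp add: basis))+
  have b22:
      "Asg [Sd, S0, Sds, S0s] = tridiag d
        (\<lambda>i. 0)
        (\<lambda>i. \<theta>s (d - i))
        (\<lambda>i. 0)"
      "Ag [Sd, S0, Sds, S0s] = tridiag d
        (\<lambda>i. \<phi>1 (d - i + 1) * ((\<Prod>h\<in>{0..<d - i}. \<theta>s (d - i) - \<theta>s h) / (\<Prod>h\<in>{0..<d - i + 1}. \<theta>s (d - i + 1) - \<theta>s h)))
        (\<lambda>i. a (d - i))
        (\<lambda>i. \<phi>2 (d - i + 1) * ((\<Prod>h\<in>{d - i + 2..d}. \<theta>s (d - i + 1) - \<theta>s h) / (\<Prod>h\<in>{d - i + 1..d}. \<theta>s (d - i) - \<theta>s h)))"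
    unfolding Ag Asg by (rule eigenbasis_matrices_reversed[OF D1 y0 trEs]; (rule splits; assumption | simp add: basis))+
  have b23:
      "Asg [S0, Sd, Sds, S0s] = tridiag d
        (\<lambda>i. 0)
        (\<lambda>i. \<theta>s (d - i))
        (\<lambda>i. 0)"
      "Ag [S0, Sd, Sds, S0s] = tridiag d
        (\<lambda>i. \<phi>2 (d - i + 1) * ((\<Prod>h\<in>{0..<d - i}. \<theta>s (d - i) - \<theta>s h) / (\<Prod>h\<in>{0..<d - i + 1}. \<theta>s (d - i + 1) - \<theta>s h)))
        (\<lambda>i. a (d - i))
        (\<lambda>i. \<phi>1 (d - i + 1) * ((\<Prod>h\<in>{d - i + 2..d}. \<theta>s (d - i + 1) - \<theta>s h) / (\<Prod>h\<in>{d - i + 1..d}. \<theta>s (d - i) - \<theta>s h)))"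
    unfolding Ag Asg by (rule eigenbasis_matrices_reversed[OF D2 yd trEs]; (rule splits; assumption | simp add: basis))+
  show ?thesis
    by (intro conjI b0 b1 b2 b3 b4 b5 b6 b7 b8 b9 b10 b11 b12 b13 b14 b15 b16 b17 b18 b19 b20 b21 b22 b23)
qed

end
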